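(* There exists a universal constant $b>0$ (not depending on $n$, $r$ or $c$) such that the following holds. Let $n,r$ be integers with $1\le r\le n/2$, let $c>0$, and let $k=\frac12 n(\log n+c)$ be an integer. Let $Q$ be the probability measure on the hyperoctahedral group $\mathbb Z_2\wr S_n$ defined in the context, let $\widetilde{Q^{*k}}$ be the probability measure on the homogeneous space $X=(\mathbb Z_2\wr S_n)/(S_r\times S_{n-r})$ induced by the $k$-fold convolution $Q^{*k}$, and let $\widetilde U$ be the uniform probability measure on $X$. Then $$\|\widetilde{Q^{*k}}-\widetilde U\|_{\mathrm{TV}}\ \le\ \tfrac12\Big[2^n\binom nr\Big]^{1/2}\|\widetilde{Q^{*k}}-\widetilde U\|_2\ \le\ b e^{-c/2}.$$
   Context: Elements of $\mathbb Z_2\wr S_n$ are pairs $(\vec v;\pi)$ with $\vec v\in\mathbb Z_2^n$, $\pi\in S_n$, with product $(\vec v;\pi)(\vec w;\sigma)=(\vec v+\pi\vec w;\pi\sigma)$, where $(\pi\vec w)_i=w_{\pi^{-1}(i)}$. Let $K\cong S_r\times S_{n-r}$ be the subgroup of elements $(\vec 0;\kappa)$ with $\kappa$ mapping $\{1,\dots,r\}$ to itself and $\{r+1,\dots,n\}$ to itself; write also $\kappa\in K$ for such permutations, and $\mathbb Z_2\wr K=\{(\vec v;\kappa):\vec v\in\mathbb Z_2^n,\kappa\in K\}$. An even transposition is an element $(\vec v;\tau)$ with $\tau=(i\,j)$ a transposition and $\vec v$ either $\vec 0$ or the vector whose nonzero entries are exactly in positions $i$ and $j$. Let $T_2$ be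 the set of even transpositions in $(\mathbb Z_2\wr K)\setminus K$ and $T_3$ the set of even transpositions not in $\mathbb Z_2\wr K$. Let $\mathcal U$ be the set of signed identities, i.e. elements $(\vec u;e)$ with $\vec u$ having exactly one nonzero entry. For a set $A$, $AK=\{ak:a\in A,k\in K\}$. The probability measure $Q$ on $\mathbb Z_2\wr S_n$ is given by $$Q(g)=\begin{cases}\dfrac{n^2-2r(n-r)}{2n^2\,r!(n-r)!}& g\in K,\\[2mm] \dfrac{1}{2n^2\,r!(n-r)!}& g\in \mathcal UK,\\[2mm] \dfrac{1}{n^2\,r!(n-r)!}& g\in T_2K,\\[2mm] \dfrac{1}{n^2\,r!(n-r)!}& g\in T_3K,\\[2mm] 0&\text{otherwise.}\end{cases}$$ $X$ is the set of left cosets of $K$ in $\mathbb Z_2\wr S_n$, so $|X|=2^n\binom nr$. A probability measure $R$ on $\mathbb Z_2\wr S_n$ induces $\widetilde R$ on $X$ by $\widetilde R(xK)=\sum_{k\in K}R(xk)$. Convolution: $(R_1*R_2)(g)=\sum_h R_1(gh^{-1})R_2(h)$; $Q^{*k}$ is the convolution of $Q$ with itself $k$ times. For probability measures $\mu,\nu$ on $X$: $\|\mu-\nu\|_{\mathrm{TV}}=\frac12\sum_{x\in X}|\mu(x)-\nu(x)|$ and $\|\mu-\nu\|_2=\big(\sum_{x\in X}|\mu(x)-\nu(x)|^2\big)^{1/2}$ (unnormalized). $\log$ is the natural logarithm. *)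

theory Defs
  imports
    Complex_Main
    "HOL-Library.Z2"
    "HOL-Combinatorics.Permutations"
    "HOL-Algebra.Coset"
    "HOL-Algebra.Left_Coset"
begin

section \<open>The hyperoctahedral group\<close>

text \<open>
  A vector in $Z_2^n$ is a function on \<open>nat\<close> that vanishes outside \<open>{1..n}\<close>; likewise
  \<open>\<pi> permutes {1..n}\<close> forces \<open>\<pi>\<close> to be the identity outside \<open>{1..n}\<close>.  Hence equality in
  the carrier is ordinary equality of pairs.
\<close>

type_synonym signed_perm = "(nat \<Rightarrow> bit) \<times> (nat \<Rightarrow> nat)"

definition bit_vectors :: "nat \<Rightarrow> (nat \<Rightarrow> bit) set" where
  "bit_vectors n = {v. \<forall>i. i \<notin> {1..n} \<longrightarrow> v i = 0}"

definition hyperoct :: "nat \<Rightarrow> signed_perm monoid" where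
  "hyperoct n =
     \<lparr>carrier = bit_vectors n \<times> {\<pi>. \<pi> permutes {1..n}},
      mult = (\<lambda>(v, \<pi>) (w, \<sigma>). (\<lambda>i. v i + w (inv_into UNIV \<pi> i), \<pi> \<circ> \<sigma>)),
      one = (\<lambda>_. 0, id)\<rparr>"

definition young_perms :: "nat \<Rightarrow> nat \<Rightarrow> (nat \<Rightarrow> nat) set" where
  "young_perms n r = {\<kappa>. \<kappa> permutes {1..n} \<and> \<kappa> ` {1..r} = {1..r} \<and> \<kappa> ` {r+1..n} = {r+1..n}}"

definition young :: "nat \<Rightarrow> nat \<Rightarrow> signed_perm set" where
  "young n r = {\<lambda>_. 0} \<times> young_perms n r"

definition signed_young :: "nat \<Rightarrow> nat \<Rightarrow> signed_perm set" where
  "signed_young n r = bit_vectors n \<times> young_perms n r"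

definition even_transpositions :: "nat \<Rightarrow> signed_perm set" where
  "even_transpositions n =
     {(v, transpose i j) | v i j. i \<in> {1..n} \<and> j \<in> {1..n} \<and> i \<noteq> j \<and>
        (v = (\<lambda>_. 0) \<or> v = (\<lambda>l. if l = i \<or> l = j then 1 else 0))}"

definition T2 :: "nat \<Rightarrow> nat \<Rightarrow> signed_perm set" where
  "T2 n r = even_transpositions n \<inter> (signed_young n r - young n r)"

definition T3 :: "nat \<Rightarrow> nat \<Rightarrow> signed_perm set" where
  "T3 n r = even_transpositions n - signed_young n r"

definition signed_identities :: "nat \<Rightarrow> signed_perm set" where
  "signed_identities n = {(\<lambda>l. if l = i then 1 else 0, id) | i. i \<in> {1..n}}"

section \<open>Measures, convolution and distances\<close>

text \<open>
  Measures on a finite set are represented by their real-valued mass functions.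
  The four nonzero cases below are pairwise disjoint, so the order of the conditionals
  is immaterial.
\<close>

definition Q :: "nat \<Rightarrow> nat \<Rightarrow> signed_perm \<Rightarrow> real" where
  "Q n r g =
    (if g \<in> young n r then
       (real n ^ 2 - 2 * real r * (real n - real r)) / (2 * real n ^ 2 * fact r * fact (n - r))
     else if g \<in> signed_identities n <#>\<^bsub>hyperoct n\<^esub> young n r then
       1 / (2 * real n ^ 2 * fact r * fact (n - r))
     else if g \<in> T2 n r <#>\<^bsub>hyperoct n\<^esub> young n r then
       1 / (real n ^ 2 * fact r * fact (n - r))
     else if g \<in> T3 n r <#>\<^bsub>hyperoct n\<^esub> young n r then
       1 / (real n ^ 2 * fact r * fact (n - r))
     else 0)"

definition convolution ::
    "('a, 'b) monoid_scheme \<Rightarrow> ('a \<Rightarrow> real) \<Rightarrow> ('a \<Rightarrow> real) \<Rightarrow> 'a \<Rightarrow> real" where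
  "convolution G R1 R2 g = (\<Sum>h\<in>carrier G. R1 (g \<otimes>\<^bsub>G\<^esub> inv\<^bsub>G\<^esub> h) * R2 h)"

primrec convolution_power ::
    "('a, 'b) monoid_scheme \<Rightarrow> ('a \<Rightarrow> real) \<Rightarrow> nat \<Rightarrow> 'a \<Rightarrow> real" where
  "convolution_power G R 0 = (\<lambda>g. if g = \<one>\<^bsub>G\<^esub> then 1 else 0)"
| "convolution_power G R (Suc k) = convolution G R (convolution_power G R k)"

text \<open>
  The induced mass of a coset $xK$ is $\sum_{k \in K} R(xk)$; it is written without a choice
  of representative, see \<open>induced_l_coset\<close> below.
\<close>

definition induced :: "('a \<Rightarrow> real) \<Rightarrow> 'a set \<Rightarrow> real" where
  "induced R C = (\<Sum>g\<in>C. R g)"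

definition cosets :: "nat \<Rightarrow> nat \<Rightarrow> signed_perm set set" where
  "cosets n r = lcosets\<^bsub>hyperoct n\<^esub> (young n r)"

definition uniform_mass :: "'a set \<Rightarrow> 'a \<Rightarrow> real" where
  "uniform_mass X x = (if x \<in> X then 1 / real (card X) else 0)"

definition tv_dist :: "'a set \<Rightarrow> ('a \<Rightarrow> real) \<Rightarrow> ('a \<Rightarrow> real) \<Rightarrow> real" where
  "tv_dist X \<mu> \<nu> = 1 / 2 * (\<Sum>x\<in>X. \<bar>\<mu> x - \<nu> x\<bar>)"

definition l2_dist :: "'a set \<Rightarrow> ('a \<Rightarrow> real) \<Rightarrow> ('a \<Rightarrow> real) \<Rightarrow> real" where
  "l2_dist X \<mu> \<nu> = sqrt (\<Sum>x\<in>X. \<bar>\<mu> x - \<nu> x\<bar> ^ 2)"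

section \<open>Well-definedness\<close>

lemma hyperoct_group: "group (hyperoct n)"
proof (rule groupI)
  fix x y assume "x \<in> carrier (hyperoct n)" "y \<in> carrier (hyperoct n)"
  moreover have "inv_into UNIV p i \<notin> {1..n}" if "p permutes {1..n}" "i \<notin> {1..n}" for p i
    using permutes_not_in[OF permutes_inv[OF that(1)] that(2)] that(2) by simp
  ultimately show "x \<otimes>\<^bsub>hyperoct n\<^esub> y \<in> carrier (hyperoct n)"
    by (cases x; cases y) (auto simp: hyperoct_def bit_vectors_def intro: permutes_compose)
next
  show "\<one>\<^bsub>hyperoct n\<^esub> \<in> carrier (hyperoct n)"
    by (simp add: hyperoct_def bit_vectors_def permutes_id)
next
  fix x y z
  assume "x \<in> carrier (hyperoct n)" "y \<in> carrier (hyperoct n)" "z \<in> carrier (hyperoct n)"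
  then show "x \<otimes>\<^bsub>hyperoct n\<^esub> y \<otimes>\<^bsub>hyperoct n\<^esub> z =
      x \<otimes>\<^bsub>hyperoct n\<^esub> (y \<otimes>\<^bsub>hyperoct n\<^esub> z)"
    by (cases x; cases y; cases z)
      (auto simp: hyperoct_def o_inv_distrib permutes_bij comp_assoc fun_eq_iff
        simp flip: bit_not_zero_iff)
next
  fix x assume "x \<in> carrier (hyperoct n)"
  then show "\<one>\<^bsub>hyperoct n\<^esub> \<otimes>\<^bsub>hyperoct n\<^esub> x = x"
    by (cases x) (auto simp: hyperoct_def)
next
  fix x assume x: "x \<in> carrier (hyperoct n)"
  obtain v p where [simp]: "x = (v, p)" by (cases x)
  have p: "p permutes {1..n}" and v: "\<And>i. i \<notin> {1..n} \<Longrightarrow> v i = 0"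
    using x by (auto simp: hyperoct_def bit_vectors_def)
  have "(\<lambda>i. v (p i), inv_into UNIV p) \<in> carrier (hyperoct n)"
    using p v permutes_not_in[OF p]
    by (auto simp: hyperoct_def bit_vectors_def permutes_inv)
  moreover have "(\<lambda>i. v (p i), inv_into UNIV p) \<otimes>\<^bsub>hyperoct n\<^esub> x = \<one>\<^bsub>hyperoct n\<^esub>"
    using p by (simp add: hyperoct_def inv_inv_eq permutes_bij permutes_inv_o fun_eq_iff
      flip: bit_not_zero_iff)
  ultimately show "\<exists>y\<in>carrier (hyperoct n). y \<otimes>\<^bsub>hyperoct n\<^esub> x = \<one>\<^bsub>hyperoct n\<^esub>"
    by blast
qed

lemma young_perms_inv:
  assumes "p \<in> young_perms n r"
  shows "inv_into UNIV p \<in> young_perms n r"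
proof -
  have p: "p permutes {1..n}" and im: "p ` {1..r} = {1..r}" "p ` {r+1..n} = {r+1..n}"
    using assms by (auto simp: young_perms_def)
  have "inv_into UNIV p ` p ` A = A" for A
    using permutes_inv_o(2)[OF p] by (simp add: image_comp)
  then show ?thesis
    using permutes_inv[OF p] im by (metis (mono_tags, lifting) mem_Collect_eq young_perms_def)
qed

lemma young_subgroup: "subgroup (young n r) (hyperoct n)"
proof
  show "young n r \<subseteq> carrier (hyperoct n)"
    by (auto simp: young_def young_perms_def hyperoct_def bit_vectors_def)
  show "\<one>\<^bsub>hyperoct n\<^esub> \<in> young n r"
    by (simp add: young_def young_perms_def hyperoct_def permutes_id)
  show "x \<otimes>\<^bsub>hyperoct n\<^esub> y \<in> young n r" if "x \<in> young n r" "y \<in> young n r" for x y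
  proof -
    have "(p \<circ> q) ` A = A" if "p ` A = A" "q ` A = A" for p q :: "nat \<Rightarrow> nat" and A
      using that by (simp only: image_comp[symmetric])
    with that show ?thesis
      by (cases x; cases y)
        (auto simp: young_def young_perms_def hyperoct_def simp del: o_apply
          intro: permutes_compose)
  qed
  show "inv\<^bsub>hyperoct n\<^esub> x \<in> young n r" if x: "x \<in> young n r" for x
  proof -
    interpret group "hyperoct n" by (rule hyperoct_group)
    obtain p where xp: "x = (\<lambda>_. 0, p)" and p: "p \<in> young_perms n r"
      using x by (auto simp: young_def)
    have pp: "p permutes {1..n}" using p by (simp add: young_perms_def)
    have "inv\<^bsub>hyperoct n\<^esub> x = (\<lambda>_. 0, inv_into UNIV p)"
    proof (rule inv_equality)
      show "(\<lambda>_. 0, inv_into UNIV p) \<otimes>\<^bsub>hyperoct n\<^esub> x = \<one>\<^bsub>hyperoct n\<^esub>"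
        using pp by (simp add: xp hyperoct_def permutes_inv_o)
      show "x \<in> carrier (hyperoct n)" "(\<lambda>_. 0, inv_into UNIV p) \<in> carrier (hyperoct n)"
        using pp by (auto simp: xp hyperoct_def bit_vectors_def permutes_inv)
    qed
    then show ?thesis
      using young_perms_inv[OF p] by (simp add: young_def)
  qed
qed

lemma induced_l_coset:
  assumes "group G" "subgroup K G" "x \<in> carrier G"
  shows "induced R (x <#\<^bsub>G\<^esub> K) = (\<Sum>k\<in>K. R (x \<otimes>\<^bsub>G\<^esub> k))"
proof -
  interpret group G by fact
  have "x <#\<^bsub>G\<^esub> K = (\<lambda>k. x \<otimes>\<^bsub>G\<^esub> k) ` K"
    by (auto simp: l_coset_def)
  moreover have "inj_on (\<lambda>k. x \<otimes>\<^bsub>G\<^esub> k) K"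
    using assms(3) subgroup.subset[OF assms(2)]
    by (intro inj_onI) (metis Units_eq Units_l_cancel subsetD)
  ultimately show ?thesis
    by (simp add: induced_def sum.reindex)
qed

end

theory Submission
  imports Defs "HOL-Analysis.Convex"
begin

text \<open>
  The left coset of \<open>(v, \<pi>)\<close> is determined by the pair \<open>(W, A)\<close> with \<open>W\<close> the support of \<open>v\<close> and
  \<open>A = \<pi> ` {1..r}\<close>, so the random walk lives on pairs of a subset of \<open>N = {1..n}\<close> and an
  \<open>r\<close>-subset.  On such pairs one step of \<open>Q\<close> picks \<open>i, j \<in> N\<close> independently and uniformly,
  replaces \<open>A\<close> by \<open>(i j) ` A\<close>, and with probability one half toggles the elements of \<open>{i, j}\<close> in
  \<open>W\<close> (\<open>Q_eq_move_count\<close>, \<open>induced_convolution_power_eq_walk\<close>).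

  A Fourier transform in \<open>W\<close> splits the step into one operator for each frequency \<open>S \<subseteq> N\<close>: up to the factor
  $1/n^2$ it is \<open>sector S (N - S)\<close>, which exchanges elements inside \<open>S\<close> and inside \<open>N - S\<close> but never
  between the two parts (\<open>fourier_walk\<close>).  By Plancherel, by self-adjointness, and because the
  return weight, summed over \<open>S\<close>, does not depend on the starting set, the squared normalized $L^2$
  distance equals $\sum_S \mathrm{tr}\,(P_S^{2k}) - 1$, where $P_S$ is \<open>sector S (N - S)\<close> divided
  by $n^2$, acting on functions of \<open>r\<close>-subsets (\<open>walk_l2_eq_trace\<close>).

  The traces are computed without diagonalizing anything.  The operator \<open>exchange S\<close> commutes with the
  operator \<open>up S\<close> which sums over the removal of one element of \<open>S\<close>.  On sets with \<open>l\<close> elements in \<open>S\<close> it equals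
  \<open>w + 2 up down\<close>, and on sets with \<open>l - 1\<close> elements in \<open>S\<close> it equals \<open>w + 2 down up\<close>, with the same
  number \<open>w = |S|\<^sup>2 - 2 l (|S| - l + 1)\<close>.  As the trace is cyclic, the difference of the traces on
  two consecutive levels is therefore multiplied by \<open>w\<close> whenever \<open>exchange S\<close> is applied.  Doing this for \<open>S\<close>
  and for \<open>N - S\<close> turns the double difference of the traces of a \<open>k\<close>-th power into a \<open>k\<close>-th power of a
  number, and summing the differences gives the eigenvalues with their multiplicities
  (\<open>level_trace_sector_pow\<close>).

  With \<open>s = |S|\<close> and \<open>m = n - s\<close> an eigenvalue has the form
  $1 - (2sm + s + 2i(s-i+1) + 2j(m-j+1))/n^2$ with \<open>2 i \<le> s\<close> and \<open>2 j \<le> m\<close>.  Its power of order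
  $2k = n(\log n + c)$ is at most a constant times $e^{-c} n^{-E}$, where the exponent \<open>E\<close> is at least
  one for all but the constant function
  (\<open>eigenvalue_power_bound\<close>).  Summing over \<open>i\<close> and \<open>j\<close> is the binomial theorem, and the number of
  frequencies of size \<open>s\<close> is absorbed by the term \<open>2 s m\<close> of the exponent, which leaves a bound of the form $C^q / q!$ with
  \<open>q = min s m\<close> (\<open>binomial_sector_weight_bound\<close>).  Hence the whole sum is at most a constant times $e^{-c}$.
  The comparison of total variation with $L^2$ is the Cauchy-Schwarz inequality.
\<close>

section \<open>Exchange operators and their traces on subsets\<close>

definition point :: "'a \<Rightarrow> 'a \<Rightarrow> real" where
  "point a x = of_bool (x = a)"

text \<open>
  With respect to the counting inner product on functions of finite sets, \<open>up S\<close> and \<open>down S\<close> are adjoint.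
  On the sets with a given number of elements in \<open>S\<close>, \<open>up S\<close> pulls functions from the level below and
  \<open>down S\<close> from the level above.
\<close>
definition up :: "'a set \<Rightarrow> ('a set \<Rightarrow> real) \<Rightarrow> 'a set \<Rightarrow> real" where
  "up S h A = (\<Sum>a\<in>A \<inter> S. h (A - {a}))"

definition down :: "'a set \<Rightarrow> ('a set \<Rightarrow> real) \<Rightarrow> 'a set \<Rightarrow> real" where
  "down S h A = (\<Sum>b\<in>S - A. h (insert b A))"

text \<open>
  All ordered pairs are counted, the diagonal included, so this is $|S|^2$ times one step of the random
  transposition walk on \<open>S\<close>.
\<close>
definition exchange :: "'a set \<Rightarrow> ('a set \<Rightarrow> real) \<Rightarrow> 'a set \<Rightarrow> real" where
  "exchange S h A = (\<Sum>i\<in>S. \<Sum>j\<in>S. h (transpose i j ` A))"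

definition linear_op :: "(('a \<Rightarrow> real) \<Rightarrow> 'a \<Rightarrow> real) \<Rightarrow> bool" where
  "linear_op X \<longleftrightarrow> (\<forall>a b f g. X (\<lambda>x. a * f x + b * g x) = (\<lambda>x. a * X f x + b * X g x))"

lemma linear_op_sum:
  assumes "linear_op X" "finite I"
  shows "X (\<lambda>x. \<Sum>i\<in>I. f i x) = (\<lambda>x. \<Sum>i\<in>I. X (f i) x)"
  using assms(2)
proof (induction I rule: finite_induct)
  case empty
  have "X (\<lambda>x. 0 * 0 + 0 * 0) = (\<lambda>x. 0 * X (\<lambda>x. 0) x + 0 * X (\<lambda>x. 0) x)"
    using assms(1)[unfolded linear_op_def, rule_format, of 0 "\<lambda>x. 0" 0 "\<lambda>x. 0"] by simp
  then show ?case by simp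
next
  case (insert i I)
  have "X (\<lambda>x. 1 * f i x + 1 * (\<Sum>i\<in>I. f i x)) = (\<lambda>x. 1 * X (f i) x + 1 * X (\<lambda>x. \<Sum>i\<in>I. f i x) x)"
    using assms(1)[unfolded linear_op_def, rule_format, of 1 "f i" 1 "\<lambda>x. \<Sum>i\<in>I. f i x"] .
  then show ?case using insert by simp
qed

lemma transpose_image_same:
  "(i \<in> A \<longleftrightarrow> j \<in> A) \<Longrightarrow> transpose i j ` A = A"
  by (auto simp: transpose_def image_iff)

lemma transpose_image_swap:
  "i \<in> A \<Longrightarrow> j \<notin> A \<Longrightarrow> transpose i j ` A = insert j (A - {i})"
  "i \<in> A \<Longrightarrow> j \<notin> A \<Longrightarrow> transpose j i ` A = insert j (A - {i})"
  by (auto simp: transpose_def image_iff)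

text \<open>
  A transposition of two elements on the same side of \<open>A\<close> fixes \<open>A\<close>; each pair across \<open>A\<close> occurs in both
  orders.
\<close>
lemma exchange_swap_sum:
  assumes "finite S"
  shows "exchange S h A = (real (card (A \<inter> S)) ^ 2 + real (card (S - A)) ^ 2) * h A
     + 2 * (\<Sum>i\<in>A \<inter> S. \<Sum>j\<in>S - A. h (insert j (A - {i})))"
proof -
  have split: "sum F S = sum F (A \<inter> S) + sum F (S - A)" for F :: "'a \<Rightarrow> real"
    using sum.Int_Diff[OF assms, of F A] by (simp add: Int_commute)
  have "exchange S h A = (\<Sum>i\<in>A \<inter> S. \<Sum>j\<in>A \<inter> S. h (transpose i j ` A))
     + (\<Sum>i\<in>A \<inter> S. \<Sum>j\<in>S - A. h (transpose i j ` A))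
     + ((\<Sum>i\<in>S - A. \<Sum>j\<in>A \<inter> S. h (transpose i j ` A))
     + (\<Sum>i\<in>S - A. \<Sum>j\<in>S - A. h (transpose i j ` A)))"
    unfolding exchange_def split by (simp add: sum.distrib)
  also have "(\<Sum>i\<in>S - A. \<Sum>j\<in>A \<inter> S. h (transpose i j ` A))
      = (\<Sum>i\<in>A \<inter> S. \<Sum>j\<in>S - A. h (insert j (A - {i})))"
    by (subst sum.swap) (auto intro!: sum.cong simp: transpose_image_swap)
  also have "(\<Sum>i\<in>A \<inter> S. \<Sum>j\<in>S - A. h (transpose i j ` A))
      = (\<Sum>i\<in>A \<inter> S. \<Sum>j\<in>S - A. h (insert j (A - {i})))"
    by (auto intro!: sum.cong simp: transpose_image_swap)
  also have "(\<Sum>i\<in>A \<inter> S. \<Sum>j\<in>A \<inter> S. h (transpose i j ` A)) = real (card (A \<inter> S)) ^ 2 * h A"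
    by (simp add: transpose_image_same power2_eq_square)
  also have "(\<Sum>i\<in>S - A. \<Sum>j\<in>S - A. h (transpose i j ` A)) = real (card (S - A)) ^ 2 * h A"
    by (simp add: transpose_image_same power2_eq_square)
  finally show ?thesis by (simp add: algebra_simps)
qed

text \<open>
  For \<open>|S| = s\<close> and \<open>2 l \<le> s\<close> this is the eigenvalue of \<open>exchange S\<close> on the part of the functions of subsets of \<open>S\<close>
  that first appears on sets of size \<open>l\<close> (the irreducible representation of shape \<open>(s - l, l)\<close>).
\<close>
definition exchange_value :: "nat \<Rightarrow> nat \<Rightarrow> real" where
  "exchange_value s l = real s ^ 2 - 2 * real l * (real s - real l + 1)"

lemma card_Diff_real:
  assumes "finite S" shows "real (card (S - A)) = real (card S) - real (card (A \<inter> S))"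
proof -
  have "card S = card (S \<inter> A) + card (S - A)" using card_Int_Diff[OF assms] by blast
  then show ?thesis by (simp add: Int_commute)
qed

text \<open>
  The product \<open>up down\<close> removes an element and puts one back: it is the swap sum plus a multiple of the
  identity, as is \<open>exchange S\<close>.
\<close>
lemma exchange_eq_up_down:
  assumes "finite S" "card (A \<inter> S) = l"
  shows "exchange S h A = exchange_value (card S) l * h A + 2 * up S (down S h) A"
proof -
  have "down S h (A - {a}) = h A + (\<Sum>j\<in>S - A. h (insert j (A - {a})))" if "a \<in> A \<inter> S" for a
  proof -
    have "S - (A - {a}) = insert a (S - A)" using that by auto
    then show ?thesis using that assms(1) by (simp add: down_def insert_absorb)
  qed
  then have "up S (down S h) A = real l * h A
      + (\<Sum>i\<in>A \<inter> S. \<Sum>j\<in>S - A. h (insert j (A - {i})))"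
    using assms(2) by (simp add: up_def sum.distrib)
  then show ?thesis
    unfolding exchange_swap_sum[OF assms(1)] exchange_value_def card_Diff_real[OF assms(1)] assms(2)
    by (simp add: power2_eq_square algebra_simps)
qed

text \<open>
  One level lower the opposite product \<open>down up\<close> appears, with the same additive constant.  That the two
  constants agree is what makes the traces on consecutive levels comparable.
\<close>
lemma exchange_eq_down_up:
  assumes "finite S" "Suc (card (A \<inter> S)) = l"
  shows "exchange S h A = exchange_value (card S) l * h A + 2 * down S (up S h) A"
proof -
  have "up S h (insert b A) = h A + (\<Sum>i\<in>A \<inter> S. h (insert b (A - {i})))" if "b \<in> S - A" for b
  proof -
    have "insert b A \<inter> S = insert b (A \<inter> S)" using that by auto
    moreover have "insert b A - {i} = insert b (A - {i})" if "i \<in> A" for i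
      using \<open>b \<in> S - A\<close> that by auto
    ultimately show ?thesis using that assms(1) by (auto simp: up_def intro!: sum.cong)
  qed
  then have "down S (up S h) A = real (card (S - A)) * h A
      + (\<Sum>j\<in>S - A. \<Sum>i\<in>A \<inter> S. h (insert j (A - {i})))"
    by (simp add: down_def sum.distrib)
  also have "(\<Sum>j\<in>S - A. \<Sum>i\<in>A \<inter> S. h (insert j (A - {i})))
     = (\<Sum>i\<in>A \<inter> S. \<Sum>j\<in>S - A. h (insert j (A - {i})))"
    by (rule sum.swap)
  finally show ?thesis
    unfolding exchange_swap_sum[OF assms(1)] exchange_value_def card_Diff_real[OF assms(1)] assms(2)[symmetric]
    by (simp add: power2_eq_square algebra_simps)
qed

lemma up_image:
  assumes "bij p" "p ` S = S"
  shows "up S h (p ` A) = up S (\<lambda>A. h (p ` A)) A"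
proof -
  have inj: "inj p" using assms(1) bij_is_inj by blast
  have "p ` A \<inter> S = p ` (A \<inter> S)" using inj assms(2) by (metis image_Int)
  then have "up S h (p ` A) = (\<Sum>a\<in>A \<inter> S. h (p ` A - {p a}))"
    by (simp add: up_def sum.reindex inj_on_subset[OF inj])
  also have "\<dots> = (\<Sum>a\<in>A \<inter> S. h (p ` (A - {a})))"
    using inj by (simp add: image_set_diff)
  finally show ?thesis by (simp add: up_def)
qed

lemma exchange_up_commute:
  assumes "S = T \<or> S \<inter> T = {}"
  shows "exchange T (up S h) = up S (exchange T h)"
proof
  fix A
  have "transpose i j ` S = S" if "i \<in> T" "j \<in> T" for i j
    using assms that by (intro transpose_image_same) auto
  then have "exchange T (up S h) A = (\<Sum>i\<in>T. \<Sum>j\<in>T. up S (\<lambda>A. h (transpose i j ` A)) A)"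
    unfolding exchange_def by (intro sum.cong refl) (simp add: up_image)
  also have "\<dots> = (\<Sum>i\<in>T. \<Sum>a\<in>A \<inter> S. \<Sum>j\<in>T. h (transpose i j ` (A - {a})))"
    unfolding up_def by (rule sum.cong[OF refl], rule sum.swap)
  also have "\<dots> = up S (exchange T h) A"
    unfolding up_def exchange_def by (rule sum.swap[of _ _ T])
  finally show "exchange T (up S h) A = up S (exchange T h) A" .
qed

text \<open>
  In the basis of point masses, \<open>up S\<close> spreads the mass at \<open>C\<close> over the sets that arise by adding an element.
\<close>
lemma up_point:
  assumes "finite S"
  shows "up S (point C) = (\<lambda>B. \<Sum>b\<in>S - C. point (insert b C) B)"
proof
  fix B
  have "up S (point C) B = (\<Sum>a\<in>B \<inter> S. of_bool (a \<notin> C \<and> B = insert a C))"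
    unfolding up_def point_def by (intro sum.cong refl) auto
  also have "\<dots> = (\<Sum>b\<in>S. of_bool (b \<notin> C \<and> B = insert b C))"
    using assms by (intro sum.mono_neutral_left) auto
  also have "\<dots> = (\<Sum>b\<in>S - C. point (insert b C) B)"
    using assms by (intro sum.mono_neutral_cong_right) (auto simp: point_def)
  finally show "up S (point C) B = (\<Sum>b\<in>S - C. point (insert b C) B)" .
qed

text \<open>
  Levels are indexed with a shift by one, so that index \<open>0\<close> is the empty level below the
  sets that are disjoint from \<open>S\<close> (or \<open>T\<close>).  Differences of consecutive levels then need no special case.
\<close>
definition level :: "'a set \<Rightarrow> 'a set \<Rightarrow> nat \<Rightarrow> nat \<Rightarrow> 'a set set" where
  "level S T l m = {A. A \<subseteq> S \<union> T \<and> Suc (card (A \<inter> S)) = l \<and> Suc (card (A \<inter> T)) = m}"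

definition level_trace ::
    "'a set \<Rightarrow> 'a set \<Rightarrow> nat \<Rightarrow> nat \<Rightarrow> (('a set \<Rightarrow> real) \<Rightarrow> 'a set \<Rightarrow> real) \<Rightarrow> real" where
  "level_trace S T l m X = (\<Sum>A\<in>level S T l m. X (point A) A)"

lemma finite_level: "finite S \<Longrightarrow> finite T \<Longrightarrow> finite (level S T l m)"
  by (rule finite_subset[of _ "Pow (S \<union> T)"]) (auto simp: level_def)

lemma level_sym: "level S T l m = level T S m l"
  by (auto simp: level_def)

text \<open>
  Both sides sum the matrix entries of \<open>X\<close> over all pairs of a set in the upper level and an element of
  it in \<open>S\<close>, or equivalently a set in the lower level and an element of \<open>S\<close> that is missing from it.
\<close>
lemma level_trace_cyclic:
  assumes fin: "finite S" "finite T" and dis: "S \<inter> T = {}" and lin: "linear_op X"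
  shows "level_trace S T (Suc l) m (\<lambda>h. up S (X h)) = level_trace S T l m (\<lambda>h. X (up S h))"
proof -
  have fins: "finite (A \<inter> S)" "finite (S - A)" for A using fin by auto
  have "level_trace S T (Suc l) m (\<lambda>h. up S (X h))
     = (\<Sum>(A, a)\<in>Sigma (level S T (Suc l) m) (\<lambda>A. A \<inter> S). X (point A) (A - {a}))"
    unfolding level_trace_def up_def by (rule sum.Sigma) (use fin finite_level in auto)
  also have "\<dots> = (\<Sum>(C, b)\<in>Sigma (level S T l m) (\<lambda>C. S - C). X (point (insert b C)) C)"
  proof (rule sum.reindex_bij_witness[where i = "\<lambda>(C, b). (insert b C, b)" and j = "\<lambda>(A, a). (A - {a}, a)"],
      goal_cases)
    case (2 x)
    then obtain A a where x: "x = (A, a)" "A \<in> level S T (Suc l) m" "a \<in> A" "a \<in> S" by auto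
    have "a \<notin> T" using x dis by auto
    then have "(A - {a}) \<inter> T = A \<inter> T" "(A - {a}) \<inter> S = A \<inter> S - {a}" by auto
    moreover have "card (A \<inter> S) = Suc (card (A \<inter> S - {a}))"
      using x fins card.remove[of "A \<inter> S" a] by auto
    ultimately show ?case using x by (auto simp: level_def)
  next
    case (4 y)
    then obtain C b where y: "y = (C, b)" "C \<in> level S T l m" "b \<notin> C" "b \<in> S" by auto
    have "b \<notin> T" using y dis by auto
    then have "insert b C \<inter> T = C \<inter> T" "insert b C \<inter> S = insert b (C \<inter> S)" using y by auto
    then show ?case using y fins by (auto simp: level_def)
  qed (auto simp: insert_absorb)
  also have "\<dots> = (\<Sum>C\<in>level S T l m. \<Sum>b\<in>S - C. X (point (insert b C)) C)"
    by (rule sum.Sigma[symmetric]) (use fin finite_level in auto)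
  also have "\<dots> = level_trace S T l m (\<lambda>h. X (up S h))"
    unfolding level_trace_def up_point[OF fin(1)] linear_op_sum[OF lin fins(2)] ..
  finally show ?thesis .
qed

lemma linear_op_down: "linear_op X \<Longrightarrow> linear_op (\<lambda>h. down S (X h))"
  unfolding linear_op_def down_def by (simp only: sum.distrib sum_distrib_left simp_thms)

text \<open>
  After writing \<open>exchange S\<close> as \<open>w + 2 up down\<close> above and \<open>w + 2 down up\<close> below, cyclicity cancels the
  products.
\<close>
lemma level_trace_exchange:
  assumes fin: "finite S" "finite T" and dis: "S \<inter> T = {}" and lin: "linear_op X"
    and comm: "\<And>h. X (up S h) = up S (X h)"
  shows "level_trace S T (Suc l) m (\<lambda>h. exchange S (X h)) - level_trace S T l m (\<lambda>h. exchange S (X h))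
    = exchange_value (card S) l * (level_trace S T (Suc l) m X - level_trace S T l m X)"
proof -
  have "level_trace S T (Suc l) m (\<lambda>h. exchange S (X h))
      = exchange_value (card S) l * level_trace S T (Suc l) m X
        + 2 * level_trace S T (Suc l) m (\<lambda>h. up S (down S (X h)))"
    unfolding level_trace_def sum_distrib_left sum.distrib[symmetric]
    by (intro sum.cong refl exchange_eq_up_down fin) (simp add: level_def)
  moreover have "level_trace S T l m (\<lambda>h. exchange S (X h))
      = exchange_value (card S) l * level_trace S T l m X
        + 2 * level_trace S T l m (\<lambda>h. down S (up S (X h)))"
    unfolding level_trace_def sum_distrib_left sum.distrib[symmetric]
    by (intro sum.cong refl exchange_eq_down_up fin) (simp add: level_def)
  moreover have "level_trace S T (Suc l) m (\<lambda>h. up S (down S (X h)))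
      = level_trace S T l m (\<lambda>h. down S (up S (X h)))"
    using level_trace_cyclic[OF fin dis linear_op_down[OF lin, of S]] by (simp add: comm)
  ultimately show ?thesis by (simp add: algebra_simps)
qed

text \<open>
  A mode that first appears at the level \<open>(l, m)\<close> is absent one level below in either index, so the double difference
  isolates these modes.
\<close>
definition level_trace_diff ::
    "'a set \<Rightarrow> 'a set \<Rightarrow> nat \<Rightarrow> nat \<Rightarrow> (('a set \<Rightarrow> real) \<Rightarrow> 'a set \<Rightarrow> real) \<Rightarrow> real" where
  "level_trace_diff S T l m X =
     (level_trace S T (Suc l) (Suc m) X - level_trace S T l (Suc m) X)
     - (level_trace S T (Suc l) m X - level_trace S T l m X)"

lemma level_trace_diff_sym: "level_trace_diff S T l m X = level_trace_diff T S m l X"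
  unfolding level_trace_diff_def level_trace_def level_sym[of S T] by simp

lemma level_trace_diff_exchange:
  assumes "finite S" "finite T" "S \<inter> T = {}" "linear_op X" "\<And>h. X (up S h) = up S (X h)"
  shows "level_trace_diff S T l m (\<lambda>h. exchange S (X h))
    = exchange_value (card S) l * level_trace_diff S T l m X"
  unfolding level_trace_diff_def
    level_trace_exchange[OF assms, of l m] level_trace_exchange[OF assms, of l "Suc m"]
  by (rule right_diff_distrib[symmetric])

text \<open>
  With \<open>T\<close> the complement of \<open>S\<close>, this is $n^2$ times the walk restricted to the Fourier
  frequency \<open>S\<close>.  The last term removes the diagonal pairs in \<open>S\<close>: there the step with and the step without
  a flip have opposite signs.
\<close>
definition sector :: "'a set \<Rightarrow> 'a set \<Rightarrow> ('a set \<Rightarrow> real) \<Rightarrow> 'a set \<Rightarrow> real" where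
  "sector S T h A = exchange S h A + exchange T h A - real (card S) * h A"

lemma sector_pow_linear_commute:
  assumes "S \<inter> T = {}"
  shows "linear_op (sector S T ^^ k)"
    "(sector S T ^^ k) (up S h) = up S ((sector S T ^^ k) h)"
    "(sector S T ^^ k) (up T h) = up T ((sector S T ^^ k) h)"
proof -
  have "linear_op (sector S T)"
    unfolding linear_op_def sector_def exchange_def
    by (simp add: sum.distrib sum_distrib_left algebra_simps)
  then show "linear_op (sector S T ^^ k)"
    by (induction k) (auto simp: linear_op_def)
  have c: "up S (sector V V' h) A = up S (exchange V h) A + up S (exchange V' h) A - real (card V) * up S h A"
    for S V V' :: "'a set" and h A
    unfolding sector_def up_def by (simp add: sum.distrib sum_distrib_left sum_subtractf)
  have "sector S T (up S h) = up S (sector S T h)" "sector S T (up T h) = up T (sector S T h)" for h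
    using assms by (auto simp: fun_eq_iff c sector_def exchange_up_commute Int_commute)
  then show "(sector S T ^^ k) (up S h) = up S ((sector S T ^^ k) h)"
    "(sector S T ^^ k) (up T h) = up T ((sector S T ^^ k) h)"
    by (induction k) auto
qed

text \<open>
  The number of subsets at the shifted level index \<open>l\<close>, that is, of size \<open>l - 1\<close>, with none for \<open>l = 0\<close>.
\<close>
definition dim_below :: "nat \<Rightarrow> nat \<Rightarrow> nat" where
  "dim_below s l = (case l of 0 \<Rightarrow> 0 | Suc i \<Rightarrow> s choose i)"

text \<open>
  The multiplicity of \<open>exchange_value s l\<close> for \<open>2 l \<le> s\<close>; for larger \<open>l\<close> it is nonpositive.
\<close>
definition multiplicity_at :: "nat \<Rightarrow> nat \<Rightarrow> real" where
  "multiplicity_at s l = real (s choose l) - real (dim_below s l)"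

lemma card_level:
  assumes "finite S" "finite T" "S \<inter> T = {}"
  shows "card (level S T l m) = dim_below (card S) l * dim_below (card T) m"
proof -
  have "bij_betw (\<lambda>A. (A \<inter> S, A \<inter> T)) (level S T l m)
     ({B. B \<subseteq> S \<and> Suc (card B) = l} \<times> {C. C \<subseteq> T \<and> Suc (card C) = m})"
  proof (rule bij_betw_byWitness[where f' = "\<lambda>(B, C). B \<union> C"], goal_cases)
    case 4
    have "(B \<union> C) \<inter> S = B" "(B \<union> C) \<inter> T = C" if "B \<subseteq> S" "C \<subseteq> T" for B C
      using that assms(3) by auto
    then show ?case by (auto simp: level_def)
  qed (use assms(3) in \<open>auto simp: level_def\<close>)
  then have "card (level S T l m)
      = card {B. B \<subseteq> S \<and> Suc (card B) = l} * card {C. C \<subseteq> T \<and> Suc (card C) = m}"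
    by (simp only: bij_betw_same_card card_cartesian_product)
  moreover have "card {B. B \<subseteq> V \<and> Suc (card B) = i} = dim_below (card V) i" if "finite V" for V :: "'a set" and i
    using n_subsets[OF that] by (cases i) (auto simp: dim_below_def)
  ultimately show ?thesis using assms by simp
qed

lemma level_trace_diff_sector_pow:
  assumes "finite S" "finite T" "S \<inter> T = {}"
  shows "level_trace_diff S T l m (sector S T ^^ k)
    = multiplicity_at (card S) l * multiplicity_at (card T) m
      * (exchange_value (card S) l + exchange_value (card T) m - real (card S)) ^ k"
proof (induction k)
  case 0
  have "level_trace S T i j (sector S T ^^ 0) = real (dim_below (card S) i) * real (dim_below (card T) j)" for i j
    using card_level[OF assms] by (simp add: level_trace_def point_def)
  then show ?case
    unfolding level_trace_diff_def multiplicity_at_def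
    by (simp add: dim_below_def algebra_simps split: nat.split)
next
  case (Suc k)
  let ?X = "sector S T ^^ k"
  note X = sector_pow_linear_commute[OF assms(3)]
  have dis': "T \<inter> S = {}" using assms(3) by auto
  have "level_trace_diff S T l m (sector S T ^^ Suc k)
    = level_trace_diff S T l m (\<lambda>h. exchange S (?X h)) + level_trace_diff S T l m (\<lambda>h. exchange T (?X h))
      - real (card S) * level_trace_diff S T l m ?X"
    unfolding level_trace_diff_def level_trace_def
    by (simp add: sector_def sum.distrib sum_subtractf sum_distrib_left algebra_simps)
  also have "level_trace_diff S T l m (\<lambda>h. exchange S (?X h))
     = exchange_value (card S) l * level_trace_diff S T l m ?X"
    using level_trace_diff_exchange[OF assms X(1,2)] .
  also have "level_trace_diff S T l m (\<lambda>h. exchange T (?X h))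
     = exchange_value (card T) m * level_trace_diff S T l m ?X"
    unfolding level_trace_diff_sym[of S T]
    using level_trace_diff_exchange[OF assms(2,1) dis' X(1,3)] .
  finally show ?case using Suc by (simp add: algebra_simps)
qed

lemma level_trace_eq_sum_diff:
  "level_trace S T (Suc l) (Suc m) X = (\<Sum>i<Suc l. \<Sum>j<Suc m. level_trace_diff S T i j X)"
proof -
  have z: "level_trace S T 0 j X = 0" "level_trace S T j 0 X = 0" for j
    by (simp_all add: level_trace_def level_def)
  have "(\<Sum>j<Suc m. level_trace_diff S T i j X)
      = level_trace S T (Suc i) (Suc m) X - level_trace S T i (Suc m) X" for i
    unfolding level_trace_diff_def
    using sum_lessThan_telescope[of "\<lambda>j. level_trace S T (Suc i) j X - level_trace S T i j X" "Suc m"]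
    by (simp only: z diff_0_right)
  then show ?thesis
    using sum_lessThan_telescope[of "\<lambda>i. level_trace S T i (Suc m) X" "Suc l"]
    by (simp only: z diff_0_right)
qed

text \<open>
  The symmetry \<open>i \<mapsto> s + 1 - i\<close> keeps the eigenvalue and flips the sign of the multiplicity; terms beyond
  the middle therefore cancel.
\<close>
lemma multiplicity_at_reflect:
  assumes "1 \<le> i" "i \<le> s"
  shows "multiplicity_at s (s + 1 - i) = - multiplicity_at s i"
    and "exchange_value s (s + 1 - i) = exchange_value s i"
proof -
  obtain j where j: "i = Suc j" using assms by (cases i) auto
  have "s + 1 - i = Suc (s - i)" using assms by simp
  moreover have "s choose (Suc (s - i)) = s choose j"
    using binomial_symmetric[of j s] assms j Suc_diff_Suc[of j s] by simp
  moreover have "s choose (s - i) = s choose i"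
    using binomial_symmetric[of i s] assms by simp
  ultimately show "multiplicity_at s (s + 1 - i) = - multiplicity_at s i"
    by (simp only: multiplicity_at_def dim_below_def j nat.case minus_diff_eq)
  have "real (s + 1 - i) = real s + 1 - real i" using assms by (simp add: of_nat_diff)
  then show "exchange_value s (s + 1 - i) = exchange_value s i"
    unfolding exchange_value_def by (simp only:) (simp add: algebra_simps)
qed

text \<open>
  Telescoping up to a level \<open>l > s / 2\<close> produces terms with negative multiplicity.  The indices from
  \<open>s - l + 1\<close> to \<open>l\<close> are exactly those exchanged by the reflection, so they sum to zero.
\<close>
lemma sum_multiplicity_truncate:
  assumes "l \<le> s"
  shows "(\<Sum>i<Suc l. multiplicity_at s i * F (exchange_value s i))
    = (\<Sum>i<Suc (min l (s - l)). multiplicity_at s i * F (exchange_value s i))"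
proof (cases "l \<le> s - l")
  case False
  let ?g = "\<lambda>i. multiplicity_at s i * F (exchange_value s i)"
  have "sum ?g {s - l + 1..l} = (\<Sum>i\<in>{s - l + 1..l}. - ?g i)"
    by (rule sum.reindex_bij_witness[of _ "\<lambda>i. s + 1 - i" "\<lambda>i. s + 1 - i"])
      (use assms in \<open>auto simp: multiplicity_at_reflect[simplified]\<close>)
  then have "sum ?g {s - l + 1..l} = 0" by (simp add: sum_negf)
  moreover have "{..<Suc l} = {..<Suc (s - l)} \<union> {s - l + 1..l}" using False by auto
  moreover have "sum ?g ({..<Suc (s - l)} \<union> {s - l + 1..l}) = sum ?g {..<Suc (s - l)} + sum ?g {s - l + 1..l}"
    by (rule sum.union_disjoint) auto
  ultimately show ?thesis using False by (simp only: min_def if_False)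
qed (simp add: min_def)

text \<open>
  This is the trace formula that a full diagonalization would give.  It holds for every power, with indices
  restricted to the range in which multiplicities are nonnegative.
\<close>
lemma level_trace_sector_pow:
  assumes "finite S" "finite T" "S \<inter> T = {}" "l \<le> card S" "m \<le> card T"
  shows "level_trace S T (Suc l) (Suc m) (sector S T ^^ k)
    = (\<Sum>i<Suc (min l (card S - l)). \<Sum>j<Suc (min m (card T - m)).
        multiplicity_at (card S) i * multiplicity_at (card T) j
        * (exchange_value (card S) i + exchange_value (card T) j - real (card S)) ^ k)"
proof -
  let ?F = "\<lambda>i y. (exchange_value (card S) i + y - real (card S)) ^ k"
  have "level_trace S T (Suc l) (Suc m) (sector S T ^^ k)
    = (\<Sum>i<Suc l. multiplicity_at (card S) i *
        (\<Sum>j<Suc m. multiplicity_at (card T) j * ?F i (exchange_value (card T) j)))"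
    unfolding level_trace_eq_sum_diff level_trace_diff_sector_pow[OF assms(1-3)] sum_distrib_left
    by (simp only: mult.assoc)
  also have "\<dots> = (\<Sum>i<Suc l. multiplicity_at (card S) i *
        (\<Sum>j<Suc (min m (card T - m)). multiplicity_at (card T) j * ?F i (exchange_value (card T) j)))"
    by (rule sum.cong[OF refl], rule arg_cong[where f = "(*) _"])
      (rule sum_multiplicity_truncate[OF assms(5), of "?F _"])
  also have "\<dots> = (\<Sum>i<Suc (min l (card S - l)). multiplicity_at (card S) i *
        (\<Sum>j<Suc (min m (card T - m)). multiplicity_at (card T) j * ?F i (exchange_value (card T) j)))"
    by (rule sum_multiplicity_truncate[OF assms(4),
        of "\<lambda>x. \<Sum>j<Suc (min m (card T - m)). multiplicity_at (card T) j * (x + exchange_value (card T) j - real (card S)) ^ k"])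
  finally show ?thesis by (simp only: sum_distrib_left mult.assoc)
qed

lemma multiplicity_at_bounds:
  assumes "2 * i \<le> s"
  shows "0 \<le> multiplicity_at s i" "multiplicity_at s i \<le> real (s choose i)"
proof -
  show "0 \<le> multiplicity_at s i"
    using assms binomial_mono[of "i - 1" i s] by (cases i) (auto simp: multiplicity_at_def dim_below_def)
qed (simp add: multiplicity_at_def)

section \<open>Decay of the eigenvalues\<close>

text \<open>
  With \<open>n = s + m\<close>, this is \<open>n\<close> times a lower bound for the spectral gap \<open>1 - \<lambda>\<close>, in which the
  quadratic expressions in \<open>i\<close> and \<open>j\<close> are replaced by linear ones.  The power of order
  $n(\log n + c)$ of \<open>\<lambda>\<close> is then roughly the power of $n e^{c}$ with the negated exponent.
\<close>
definition decay_exponent :: "nat \<Rightarrow> nat \<Rightarrow> nat \<Rightarrow> nat \<Rightarrow> real" where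
  "decay_exponent s m i j = (2 * real s * real m + real s + real i * (real s + 2) + real j * (real m + 2))
     / (real s + real m)"

text \<open>
  Linear lower and quadratic upper bounds for \<open>i (s - i + 1)\<close>, which increases up to the middle of the range.
\<close>
lemma mode_bounds:
  fixes s i :: nat
  assumes "2 * i \<le> s"
  shows "real i * (real s + 2) \<le> 2 * real i * (real s - real i + 1)"
    and "4 * real i * (real s - real i + 1) \<le> real s * (real s + 2)"
proof -
  have le: "2 * real i \<le> real s" using assms by linarith
  have "real i * (real s + 2) \<le> real i * (2 * (real s - real i + 1))"
    using le by (intro mult_left_mono) auto
  then show "real i * (real s + 2) \<le> 2 * real i * (real s - real i + 1)" by (simp add: algebra_simps)
  have "0 \<le> (real s - 2 * real i) * (real s - 2 * real i + 2)" using le by simp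
  then show "4 * real i * (real s - real i + 1) \<le> real s * (real s + 2)"
    by (simp add: algebra_simps power2_eq_square)
qed

text \<open>
  Equality holds for \<open>s = 2\<close>, \<open>i = 1\<close>, \<open>m = 0\<close>.  After division by $n^2$ this says that negative eigenvalues are tiny.
\<close>
lemma eigenvalue_lower:
  assumes "2 * i \<le> s" "2 * j \<le> m"
  shows "- 2 \<le> exchange_value s i + exchange_value m j - real s"
proof -
  have "exchange_value s i - real s \<ge> (real s - 2) ^ 2 / 2 - 2"
    using mode_bounds(2)[OF assms(1)] by (simp add: exchange_value_def power2_eq_square field_simps)
  moreover have "0 \<le> (real s - 2) ^ 2 / 2" by simp
  moreover have "exchange_value m j \<ge> 0"
  proof (cases "j = 0")
    case False
    then have "2 \<le> real m" using assms(2) by linarith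
    then have "0 \<le> real m * (real m - 2)" by simp
    then show ?thesis
      using mode_bounds(2)[OF assms(2)] by (simp add: exchange_value_def power2_eq_square algebra_simps)
  qed (simp add: exchange_value_def)
  ultimately show ?thesis by linarith
qed

lemma decay_exponent_ge_1:
  assumes "0 < s + m" "2 * i \<le> s" "(s, i, j) \<noteq> (0, 0, 0)"
  shows "1 \<le> decay_exponent s m i j"
proof -
  have "real s + real m \<le> 2 * real s * real m + real s + real i * (real s + 2) + real j * (real m + 2)"
  proof (cases "s = 0")
    case True
    have "real m \<le> 1 * (real m + 2)" by simp
    also have "\<dots> \<le> real j * (real m + 2)"
      using True assms by (intro mult_right_mono) auto
    finally show ?thesis using True assms(2) by simp
  next
    case False
    then have "1 * real m \<le> real s * real m" by (intro mult_right_mono) auto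
    moreover have "0 \<le> real i * (real s + 2)" "0 \<le> real j * (real m + 2)" by simp_all
    ultimately show ?thesis using False by linarith
  qed
  moreover have "0 < real s + real m" using assms(1) by linarith
  ultimately show ?thesis unfolding decay_exponent_def by (simp only: le_divide_eq if_True mult_1)
qed

text \<open>
  A nonnegative eigenvalue \<open>1 - y\<close> is at most $e^{-y}$.  A negative one is at most $2/n^2$ in absolute value,
  which is below the same bound as soon as \<open>n \<ge> 3\<close>.  For \<open>n = 2\<close> the eigenvalue \<open>-1/2\<close> violates
  it; the factor \<open>8\<close> makes up for this.
\<close>
lemma eigenvalue_power_bound:
  fixes c :: real and s m i j K :: nat
  defines "n \<equiv> s + m"
  assumes ij: "2 * i \<le> s" "2 * j \<le> m" and nontriv: "(s, i, j) \<noteq> (0, 0, 0)"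
    and n: "2 \<le> n" and c: "0 < c" and K: "real K = real n * (ln (real n) + c)" and ev: "even K"
  shows "((exchange_value s i + exchange_value m j - real s) / real n ^ 2) ^ K
    \<le> 8 * exp (- c) * real n powr (- decay_exponent s m i j)"
proof -
  define L where "L = exchange_value s i + exchange_value m j - real s"
  define x where "x = L / real n ^ 2"
  define E where "E = decay_exponent s m i j"
  have npos: "0 < real n" using n by simp
  have nsm: "real n = real s + real m" by (simp add: n_def)
  have E1: "1 \<le> E" unfolding E_def 
    by (rule decay_exponent_ge_1[OF _ ij(1) nontriv]) (use n in \<open>simp add: n_def; linarith\<close>)
  have "real n * E = 2 * real s * real m + real s + real i * (real s + 2) + real j * (real m + 2)"
    using npos unfolding E_def decay_exponent_def nsm by simp
  then have nE: "real n * E \<le> real n ^ 2 - L"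
    using mode_bounds(1)[OF ij(1)] mode_bounds(1)[OF ij(2)]
    unfolding L_def exchange_value_def nsm
    by (simp add: power2_eq_square algebra_simps)
  have Lm2: "- 2 \<le> L" unfolding L_def using eigenvalue_lower[OF ij] .
  have pw: "real n powr (- E) = exp (- E * ln (real n))"
    using npos by (simp add: powr_def)
  have even_abs: "x ^ K = \<bar>x\<bar> ^ K" using ev by (simp add: power_even_abs)
  have main: "x ^ K \<le> exp (- c) * real n powr (- E)" if "\<bar>x\<bar> \<le> exp (- (E / real n))"
  proof -
    have "\<bar>x\<bar> ^ K \<le> exp (- (E / real n)) ^ K" using that by (intro power_mono) auto
    also have "\<dots> = exp (- E * (ln (real n) + c))"
      using npos by (simp add: exp_of_nat_mult[symmetric] K)
    also have "\<dots> = exp (- E * c) * real n powr (- E)"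
      unfolding pw by (simp add: exp_add[symmetric] algebra_simps)
    also have "\<dots> \<le> exp (- c) * real n powr (- E)"
      using E1 c by (intro mult_right_mono) auto
    finally show ?thesis using even_abs by simp
  qed
  have En: "E / real n \<le> 1 - x"
    using nE npos by (simp add: x_def field_simps power2_eq_square)
  have weak: "exp (- c) * real n powr (- E) \<le> 8 * exp (- c) * real n powr (- E)" by simp
  consider "0 \<le> L" | "L < 0" "3 \<le> n" | "L < 0" "n = 2" using n by linarith
  then have "x ^ K \<le> 8 * exp (- c) * real n powr (- E)"
  proof cases
    case 1
    then have "\<bar>x\<bar> \<le> 1 + - (E / real n)" using En by (simp add: x_def)
    also have "\<dots> \<le> exp (- (E / real n))" by (rule exp_ge_add_one_self)
    finally show ?thesis using main weak by linarith
  next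
    case 2
    have "9 \<le> real n ^ 2" using 2 power_mono[of 3 "real n" 2] by simp
    then have "2 / real n ^ 2 \<le> 2 / 9" using npos by (intro divide_left_mono) auto
    moreover have ax: "\<bar>x\<bar> \<le> 2 / real n ^ 2"
      unfolding x_def abs_divide using 2 Lm2 divide_right_mono[of "- L" 2 "real n ^ 2"] by simp
    ultimately have x9: "\<bar>x\<bar> \<le> 2 / 9" by linarith
    \<comment> \<open>As \<open>E / n \<le> 1 - x \<le> 11 / 9\<close>, it suffices that $e^{-11/9} \ge 2/9$; splitting the exponent into four makes \<open>1 + t \<le> exp t\<close> sharp enough.\<close>
    have "(25 / 36) ^ 4 \<le> exp (- (11 / 36) :: real) ^ 4"
      using exp_ge_add_one_self[of "- (11 / 36) :: real"] by (intro power_mono) auto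
    also have "\<dots> = exp (- (11 / 9))" by (simp add: exp_of_nat_mult[symmetric])
    also have "exp (- (11 / 9)) \<le> exp (- (E / real n))"
      unfolding exp_le_cancel_iff using En x9 by linarith
    finally have "2 / 9 \<le> exp (- (E / real n))" by (simp add: power4_eq_xxxx)
    then show ?thesis using x9 main weak by linarith
  next
    case 3
    have "\<bar>x\<bar> \<le> 1 / 2" using 3 Lm2 by (simp add: x_def)
    also have "\<dots> \<le> exp (- (1 / 2) :: real)"
      using exp_ge_add_one_self[of "- (1 / 2) :: real"] by simp
    finally have "\<bar>x\<bar> ^ K \<le> exp (- (1 / 2)) ^ K" by (intro power_mono) auto
    also have "\<dots> = exp (- (ln 2 + c))"
      using K 3 by (simp add: exp_of_nat_mult[symmetric] field_simps)
    also have "\<dots> \<le> exp (- c)" by simp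
    finally have "x ^ K \<le> exp (- c)" using even_abs by simp
    moreover have "E \<le> 3" using nE 3 Lm2 by simp
    then have "2 powr (- 3) \<le> (2::real) powr (- E)" by (intro powr_mono) auto
    then have "1 \<le> 8 * (2::real) powr (- E)" by (simp add: powr_minus)
    then have "exp (- c) * 1 \<le> exp (- c) * (8 * 2 powr (- E))" by (intro mult_left_mono) auto
    ultimately have "x ^ K \<le> exp (- c) * (8 * 2 powr (- E))" by linarith
    then show ?thesis using 3 by (simp only: mult_ac of_nat_numeral)
  qed
  then show ?thesis unfolding x_def L_def E_def .
qed

text \<open>
  The sum of the bounds $n^{-E}$ over all \<open>i\<close> and \<open>j\<close>, each weighted by its number of subsets, in the closed form that
  the binomial theorem provides.
\<close>
definition sector_weight :: "nat \<Rightarrow> nat \<Rightarrow> real" where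
  "sector_weight s m = (let n = real s + real m in
     n powr (- ((2 * real s * real m + real s) / n))
     * (1 + n powr (- ((real s + 2) / n))) ^ s * (1 + n powr (- ((real m + 2) / n))) ^ m)"

lemma sum_binomial_power_le:
  fixes a :: real
  assumes "0 \<le> a" "I \<le> Suc s"
  shows "(\<Sum>i<I. real (s choose i) * a ^ i) \<le> (1 + a) ^ s"
proof -
  have "(\<Sum>i<I. real (s choose i) * a ^ i) \<le> (\<Sum>i\<le>s. real (s choose i) * a ^ i)"
    using assms by (intro sum_mono2) auto
  also have "\<dots> = (1 + a) ^ s"
    using binomial_ring[of a 1 s] by (simp add: add.commute)
  finally show ?thesis .
qed

lemma sum_modes_le_sector_weight:
  assumes "0 < s + m" "I \<le> Suc s" "J \<le> Suc m"
  shows "(\<Sum>i<I. \<Sum>j<J. real (s choose i) * real (m choose j)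
      * real (s + m) powr (- decay_exponent s m i j)) \<le> sector_weight s m"
proof -
  define n where "n = real s + real m"
  define a where "a = n powr (- ((real s + 2) / n))"
  define b where "b = n powr (- ((real m + 2) / n))"
  define p where "p = n powr (- ((2 * real s * real m + real s) / n))"
  have n: "0 < n" "n = real (s + m)" using assms(1) by (auto simp: n_def)
  have "n powr (- decay_exponent s m i j) = p * a ^ i * b ^ j" for i j
    unfolding p_def a_def b_def decay_exponent_def n_def[symmetric]
    using n(1) by (simp add: powr_powr powr_add[symmetric] powr_realpow[symmetric] add_divide_distrib algebra_simps)
  then have "(\<Sum>i<I. \<Sum>j<J. real (s choose i) * real (m choose j)
      * real (s + m) powr (- decay_exponent s m i j))
    = p * ((\<Sum>i<I. real (s choose i) * a ^ i) * (\<Sum>j<J. real (m choose j) * b ^ j))"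
    unfolding sum_product unfolding sum_distrib_left n(2)[symmetric]
    by (intro sum.cong refl) simp
  also have "\<dots> \<le> p * ((1 + a) ^ s * (1 + b) ^ m)"
    by (intro mult_left_mono mult_mono sum_binomial_power_le assms)
      (auto simp: a_def b_def p_def intro!: sum_nonneg)
  finally show ?thesis unfolding sector_weight_def Let_def n_def[symmetric] a_def b_def p_def
    by (simp add: mult.assoc)
qed

text \<open>In the variable \<open>t\<close> this is the chord bound on \<open>[0, 1]\<close> for the convex function $x^t$.\<close>
lemma powr_le_linear:
  fixes x t :: real
  assumes "0 < x" "0 \<le> t" "t \<le> 1"
  shows "x powr t \<le> 1 + t * (x - 1)"
proof -
  have "exp ((1 - t) * 0 + t * ln x) \<le> (1 - t) * exp 0 + t * exp (ln x)"
    using convex_onD[OF exp_convex, of t 0 "ln x"] assms by simp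
  then show ?thesis using assms by (simp add: powr_def algebra_simps)
qed

text \<open>
  For the larger part \<open>p\<close> the product of \<open>p\<close> with the base term is at most $n^{q/n}$, and \<open>powr_le_linear\<close> turns
  this into a bound linear in the size \<open>q\<close> of the smaller part.
\<close>
lemma large_factor_bound:
  assumes "q \<le> p" "0 < p"
  defines "n \<equiv> real q + real p"
  shows "(1 + n powr (- ((real p + 2) / n))) ^ p \<le> exp (1 + real q)"
proof -
  have n: "1 \<le> n" "0 < n" using assms(2) unfolding n_def by auto
  have "real p * n powr (- ((real p + 2) / n)) \<le> n * n powr (- (real p / n))"
    using n assms(2) by (intro mult_mono powr_mono) (auto simp: n_def divide_right_mono)
  also have "\<dots> = n powr (1 + - (real p / n))"
    using n powr_add[of n 1 "- (real p / n)"] by simp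
  also have "1 + - (real p / n) = real q / n" using n by (simp add: n_def field_simps)
  also have "n powr (real q / n) \<le> 1 + real q / n * (n - 1)"
    using n by (intro powr_le_linear) (auto simp: n_def)
  also have "\<dots> \<le> 1 + real q" using n by (simp add: field_simps)
  finally have le: "real p * n powr (- ((real p + 2) / n)) \<le> 1 + real q" .
  have "(1 + n powr (- ((real p + 2) / n))) ^ p \<le> exp (n powr (- ((real p + 2) / n))) ^ p"
    by (intro power_mono exp_ge_add_one_self) auto
  also have "\<dots> = exp (real p * n powr (- ((real p + 2) / n)))"
    by (simp add: exp_of_nat_mult)
  finally show ?thesis using le by (meson exp_le_cancel_iff order_trans)
qed

lemma small_factor_bound:
  assumes "1 \<le> (n::real)"
  shows "(1 + n powr (- ((real q + 2) / n))) ^ q \<le> 2 ^ q"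
  using powr_mono[of "- ((real q + 2) / n)" 0 n] assms by (intro power_mono) auto

text \<open>
  The binomial coefficient is at most $n^q / q!$, and the hypothesis says that the negative power cancels $n^q$.
\<close>
lemma binomial_prefactor_bound:
  assumes "0 < n" "real q * real n \<le> e"
  shows "real (n choose q) * real n powr (- (e / real n)) \<le> 1 / fact q"
proof -
  have "real (n choose q) * fact q \<le> real n ^ q"
    using binomial_fact_pow[of n q] by (metis of_nat_fact of_nat_le_iff of_nat_mult of_nat_power)
  then have "real (n choose q) \<le> real n powr real q / fact q"
    using assms(1) by (simp add: powr_realpow le_divide_eq)
  moreover have "real n powr (- (e / real n)) \<le> real n powr (- real q)"
    using assms by (intro powr_mono) (auto simp: le_divide_eq)
  ultimately have "real (n choose q) * real n powr (- (e / real n))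
      \<le> real n powr real q / fact q * real n powr (- real q)"
    by (intro mult_mono) auto
  also have "\<dots> = 1 / fact q" using assms(1) by (simp add: powr_minus)
  finally show ?thesis .
qed

text \<open>
  Of the two binomial sums in the weight, the one over the smaller part contributes at most $2^q$ and the one over the
  larger part is \<open>large_factor_bound\<close>.
\<close>
lemma binomial_sector_weight_bound:
  assumes "0 < s + m"
  defines "q \<equiv> min s m"
  shows "real (s + m choose s) * sector_weight s m \<le> 2 ^ q * exp (1 + real q) / fact q"
proof -
  define n where "n = s + m"
  have n: "0 < n" "1 \<le> real n" using assms(1) by (auto simp: n_def)
  define W where "W = (1 + real n powr (- ((real s + 2) / real n))) ^ s
    * (1 + real n powr (- ((real m + 2) / real n))) ^ m"
  have W: "W \<le> 2 ^ q * exp (1 + real q)"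
  proof (cases "s \<le> m")
    case True
    then show ?thesis
      unfolding W_def q_def using small_factor_bound[of "real n" s] large_factor_bound[of s m] n
      by (intro mult_mono) (auto simp: n_def)
  next
    case False
    then show ?thesis
      unfolding W_def q_def mult.commute[of "2 ^ min s m"]
      using small_factor_bound[of "real n" m] large_factor_bound[of m s] n
      by (intro mult_mono) (auto simp: n_def add.commute)
  qed
  have nq: "n choose s = n choose q"
    using binomial_symmetric[of s n] by (auto simp: q_def n_def min_def)
  have "real q * real n \<le> 2 * real s * real m + real s"
  proof (cases "s \<le> m")
    case True
    then have "real s * real s \<le> real s * real m" by (intro mult_left_mono) auto
    then show ?thesis using True by (simp add: q_def n_def algebra_simps)
  next
    case False
    then have "real m * real m \<le> real s * real m" by (intro mult_right_mono) auto
    then show ?thesis using False by (simp add: q_def n_def algebra_simps)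
  qed
  then have pre: "real (n choose q) * real n powr (- ((2 * real s * real m + real s) / real n)) \<le> 1 / fact q"
    using n by (intro binomial_prefactor_bound) (auto simp: q_def n_def)
  have "real (s + m choose s) * sector_weight s m
     = (real (n choose q) * real n powr (- ((2 * real s * real m + real s) / real n))) * W"
    unfolding sector_weight_def W_def Let_def nq[unfolded n_def] by (simp add: n_def mult.assoc)
  also have "\<dots> \<le> 1 / fact q * (2 ^ q * exp (1 + real q))"
    by (intro mult_mono pre W) (auto simp: W_def)
  finally show ?thesis by simp
qed

lemma sum_exp_series_le:
  fixes x :: real assumes "0 \<le> x" shows "(\<Sum>q\<le>n. x ^ q / fact q) \<le> exp x"
proof -
  have "(\<lambda>q. x ^ q / fact q) sums exp x"
    using exp_converges[of x] by (simp add: divide_inverse mult.commute)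
  then show ?thesis
    using assms sum_le_suminf[of "\<lambda>q. x ^ q / fact q" "{..n}"] by (auto simp: sums_iff)
qed

text \<open>
  The bound for size \<open>s\<close> depends on \<open>min s (n - s)\<close> only, so the sum is at most twice an exponential series.
  The extra factor \<open>min s (n - s) + 1\<close> counts the possible sizes of the intersection of an \<open>r\<close>-subset with a set of
  size \<open>s\<close>.
\<close>
lemma sum_sector_weights_bound:
  assumes "0 < n"
  shows "(\<Sum>s\<le>n. real (n choose s) * (real (min s (n - s) + 1) * sector_weight s (n - s)))
    \<le> 2 * exp 1 * exp (4 * exp 1)"
proof -
  \<comment> \<open>The factor $2^q (q+1) \le 4^q$ is absorbed into the base of the exponential series.\<close>
  define F :: "nat \<Rightarrow> real" where "F q = exp 1 * ((4 * exp 1) ^ q / fact q)" for q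
  have "real (n choose s) * (real (min s (n - s) + 1) * sector_weight s (n - s)) \<le> F s + F (n - s)"
    if "s \<le> n" for s
  proof -
    define q where "q = min s (n - s)"
    have "real (q + 1) \<le> 2 ^ q"
      by (metis Suc_eq_plus1 Suc_leI less_exp of_nat_le_iff of_nat_numeral of_nat_power)
    moreover have "real (n choose s) * sector_weight s (n - s) \<le> 2 ^ q * exp (1 + real q) / fact q"
      using binomial_sector_weight_bound[of s "n - s"] that assms by (simp add: q_def)
    moreover have "0 \<le> real (n choose s) * sector_weight s (n - s)"
      by (simp add: sector_weight_def Let_def)
    ultimately have "real (q + 1) * (real (n choose s) * sector_weight s (n - s))
        \<le> 2 ^ q * (2 ^ q * exp (1 + real q) / fact q)"
      by (intro mult_mono) auto
    also have "\<dots> = F q"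
    proof -
      have "exp (1 + real q) = exp 1 * exp 1 ^ q"
        using exp_of_nat_mult[of q "1::real"] by (simp add: exp_add)
      moreover have "(4 * exp 1) ^ q = 2 ^ q * 2 ^ q * (exp 1 :: real) ^ q"
        unfolding power_mult_distrib[symmetric] by simp
      ultimately show ?thesis by (simp only: F_def times_divide_eq_right mult_ac)
    qed
    also have "F q \<le> F s + F (n - s)" unfolding q_def min_def by (simp add: F_def)
    finally show ?thesis unfolding q_def by (simp only: mult_ac)
  qed
  then have "(\<Sum>s\<le>n. real (n choose s) * (real (min s (n - s) + 1) * sector_weight s (n - s)))
      \<le> (\<Sum>s\<le>n. F s + F (n - s))"
    by (intro sum_mono) auto
  also have "\<dots> = 2 * (\<Sum>s\<le>n. F s)"
    using sum.nat_diff_reindex[of F "Suc n"] by (simp add: sum.distrib lessThan_Suc_atMost)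
  also have "(\<Sum>s\<le>n. F s) \<le> exp 1 * exp (4 * exp 1)"
    unfolding F_def sum_distrib_left[symmetric] by (intro mult_left_mono sum_exp_series_le) auto
  finally show ?thesis by simp
qed

section \<open>The total trace\<close>

text \<open>
  The value \<open>1\<close> added for \<open>s = 0\<close> is the contribution of the constant function, the only mode that does not decay.
\<close>
lemma level_trace_sector_pow_bound:
  fixes c :: real and K :: nat and S T :: "'a set"
  defines "s \<equiv> card S" and "m \<equiv> card T"
  defines "n \<equiv> s + m"
  assumes fin: "finite S" "finite T" and dis: "S \<inter> T = {}" and n: "2 \<le> n" and c: "0 < c"
    and K: "real K = real n * (ln (real n) + c)" and ev: "even K"
    and l: "l \<le> s" "l' \<le> m"
  shows "level_trace S T (Suc l) (Suc l') (sector S T ^^ K) / (real n ^ 2) ^ K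
    \<le> 8 * exp (- c) * sector_weight s m + of_bool (s = 0)"
proof -
  define I J where "I = Suc (min l (s - l))" and "J = Suc (min l' (m - l'))"
  define v where "v i j = exchange_value s i + exchange_value m j - real s" for i j
  let ?w = "\<lambda>i j. real (s choose i) * real (m choose j) * real n powr (- decay_exponent s m i j)"
  have "level_trace S T (Suc l) (Suc l') (sector S T ^^ K) / (real n ^ 2) ^ K
    = (\<Sum>i<I. \<Sum>j<J. multiplicity_at s i * multiplicity_at m j * (v i j / real n ^ 2) ^ K)"
    using level_trace_sector_pow[OF fin dis, of l l' K] l
    unfolding I_def J_def v_def s_def m_def
    by (simp only: sum_divide_distrib power_divide times_divide_eq_right)
  also have "\<dots> \<le> (\<Sum>i<I. \<Sum>j<J. 8 * exp (- c) * ?w i j + of_bool (s = 0 \<and> i = 0 \<and> j = 0))"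
  proof (intro sum_mono)
    fix i j assume "i \<in> {..<I}" "j \<in> {..<J}"
    then have ij: "2 * i \<le> s" "2 * j \<le> m" using l by (auto simp: I_def J_def)
    show "multiplicity_at s i * multiplicity_at m j * (v i j / real n ^ 2) ^ K
      \<le> 8 * exp (- c) * ?w i j + of_bool (s = 0 \<and> i = 0 \<and> j = 0)"
    proof (cases "s = 0 \<and> i = 0 \<and> j = 0")
      case True
      then have "v i j / real n ^ 2 = 1"
        using n by (simp add: v_def exchange_value_def n_def)
      moreover have "multiplicity_at s i = 1" "multiplicity_at m j = 1"
        using True by (simp_all add: multiplicity_at_def dim_below_def)
      ultimately have "multiplicity_at s i * multiplicity_at m j * (v i j / real n ^ 2) ^ K = 1"
        by (simp only: power_one mult_1)
      moreover have "0 \<le> 8 * exp (- c) * ?w i j" by simp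
      ultimately show ?thesis unfolding of_bool_eq_1_iff[THEN iffD2, OF True] by linarith
    next
      case False
      have "multiplicity_at s i * multiplicity_at m j * (v i j / real n ^ 2) ^ K
        \<le> (real (s choose i) * real (m choose j)) * (8 * exp (- c) * real n powr (- decay_exponent s m i j))"
      proof (intro mult_mono multiplicity_at_bounds ij)
        show "(v i j / real n ^ 2) ^ K \<le> 8 * exp (- c) * real n powr (- decay_exponent s m i j)"
          unfolding v_def n_def using False ij n c K ev
          by (intro eigenvalue_power_bound) (auto simp: n_def)
        show "0 \<le> (v i j / real n ^ 2) ^ K" using ev by (rule zero_le_even_power)
      qed auto
      then show ?thesis using False by (simp only: mult_ac of_bool_eq add_0_right)
    qed
  qed
  also have "\<dots> = 8 * exp (- c) * (\<Sum>i<I. \<Sum>j<J. ?w i j)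
      + (\<Sum>i<I. \<Sum>j<J. of_bool (s = 0 \<and> i = 0 \<and> j = 0))"
    by (simp only: sum.distrib sum_distrib_left)
  also have "(\<Sum>i<I. \<Sum>j<J. of_bool (s = 0 \<and> i = 0 \<and> j = 0)) = (of_bool (s = 0) :: real)"
    by (auto simp: I_def J_def of_bool_def sum.If_cases if_distrib[of "sum _"] sum.delta
      simp del: sum.lessThan_Suc cong: if_cong)
  also have "(\<Sum>i<I. \<Sum>j<J. ?w i j) \<le> sector_weight s m"
    unfolding n_def by (rule sum_modes_le_sector_weight) (use n l in \<open>auto simp: n_def I_def J_def\<close>)
  finally show ?thesis by simp
qed

text \<open>
  The \<open>r\<close>-subsets are distributed over levels by the size of their intersection with \<open>S\<close>.  For \<open>S = {}\<close> there
  is exactly one level, and hence the non-decaying mode is counted once.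
\<close>
lemma sector_trace_bound:
  fixes c :: real and r K :: nat and S T :: "'a set"
  defines "s \<equiv> card S" and "m \<equiv> card T"
  defines "n \<equiv> s + m"
  assumes fin: "finite S" "finite T" and dis: "S \<inter> T = {}" and n: "2 \<le> n" and c: "0 < c"
    and K: "real K = real n * (ln (real n) + c)" and ev: "even K" and r: "2 * r \<le> n"
  shows "(\<Sum>A\<in>{A. A \<subseteq> S \<union> T \<and> card A = r}. (sector S T ^^ K) (point A) A) / (real n ^ 2) ^ K
    - of_bool (S = {}) \<le> 8 * exp (- c) * (real (min s m + 1) * sector_weight s m)"
proof -
  define Ls where "Ls = {l. l \<le> s \<and> l \<le> r \<and> r - l \<le> m}"
  let ?tr = "\<lambda>l. level_trace S T (Suc l) (Suc (r - l)) (sector S T ^^ K)"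
  let ?B = "8 * exp (- c) * sector_weight s m"
  have finL: "finite Ls" by (rule finite_subset[of _ "{..s}"]) (auto simp: Ls_def)
  have split: "card A = card (A \<inter> S) + card (A \<inter> T)" if "A \<subseteq> S \<union> T" for A
  proof -
    have "A = (A \<inter> S) \<union> (A \<inter> T)" using that by auto
    moreover have "card ((A \<inter> S) \<union> (A \<inter> T)) = card (A \<inter> S) + card (A \<inter> T)"
      using fin dis by (intro card_Un_disjoint) auto
    ultimately show ?thesis by simp
  qed
  have le: "card (A \<inter> S) \<le> s" "card (A \<inter> T) \<le> m" for A
    using fin by (auto simp: s_def m_def intro: card_mono)
  have "{A. A \<subseteq> S \<union> T \<and> card A = r} = (\<Union>l\<in>Ls. level S T (Suc l) (Suc (r - l)))"
    using split le by (fastforce simp: Ls_def level_def)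
  then have "(\<Sum>A\<in>{A. A \<subseteq> S \<union> T \<and> card A = r}. (sector S T ^^ K) (point A) A) = (\<Sum>l\<in>Ls. ?tr l)"
    unfolding level_trace_def using finL fin
    by (simp only:) (subst sum.UNION_disjoint, auto simp: finite_level, auto simp: level_def)
  then have eq: "(\<Sum>A\<in>{A. A \<subseteq> S \<union> T \<and> card A = r}. (sector S T ^^ K) (point A) A) / (real n ^ 2) ^ K
     = (\<Sum>l\<in>Ls. ?tr l / (real n ^ 2) ^ K)"
    by (simp only: sum_divide_distrib)
  have tr: "?tr l / (real n ^ 2) ^ K \<le> ?B + of_bool (s = 0)" if "l \<in> Ls" for l
    unfolding s_def m_def n_def
    by (rule level_trace_sector_pow_bound[OF fin dis _ c _ ev])
      (use that n K in \<open>auto simp: s_def m_def n_def Ls_def\<close>)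
  have w: "0 \<le> sector_weight s m" by (simp add: sector_weight_def Let_def)
  show ?thesis
  proof (cases "s = 0")
    case True
    then have "Ls = {0}" "S = {}" using r fin by (auto simp: Ls_def n_def s_def)
    then show ?thesis using tr[of 0] True unfolding eq by (simp add: min_def)
  next
    case False
    have "Ls \<subseteq> {..s}" "Ls \<subseteq> {r - m..r}" by (auto simp: Ls_def)
    then have "card Ls \<le> card {..s}" "card Ls \<le> card {r - m..r}" by (metis card_mono finite_atMost, metis card_mono finite_atLeastAtMost)
    then have "card Ls \<le> min s m + 1" by auto
    then have cL: "real (card Ls) \<le> real (min s m + 1)" by (simp only: of_nat_le_iff)
    have "(\<Sum>l\<in>Ls. ?tr l / (real n ^ 2) ^ K) \<le> (\<Sum>l\<in>Ls. ?B)"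
      using tr False by (intro sum_mono) auto
    also have "\<dots> = real (card Ls) * ?B" by simp
    also have "\<dots> \<le> real (min s m + 1) * ?B" using cL w by (intro mult_right_mono) auto
    finally have "(\<Sum>l\<in>Ls. ?tr l / (real n ^ 2) ^ K) \<le> real (min s m + 1) * ?B" .
    moreover have "S \<noteq> {}" using False by (auto simp: s_def)
    ultimately show ?thesis unfolding eq by (simp only: mult_ac of_bool_eq diff_0_right)
  qed
qed

lemma sum_Pow_card:
  fixes h :: "nat \<Rightarrow> real"
  assumes "finite N"
  shows "(\<Sum>S\<in>Pow N. h (card S)) = (\<Sum>s\<le>card N. real (card N choose s) * h s)"
proof -
  have "(\<Sum>S\<in>Pow N. h (card S)) = (\<Sum>s\<le>card N. \<Sum>S\<in>{S \<in> Pow N. card S = s}. h (card S))"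
    using assms by (intro sum.group[symmetric]) (auto intro: card_mono)
  also have "\<dots> = (\<Sum>s\<le>card N. real (card N choose s) * h s)"
    using n_subsets[OF assms] by (intro sum.cong refl) (simp add: Pow_def)
  finally show ?thesis .
qed

lemma total_trace_bound:
  fixes c :: real and r K :: nat and N :: "'a set"
  defines "n \<equiv> card N"
  assumes fin: "finite N" and n: "2 \<le> n" and c: "0 < c"
    and K: "real K = real n * (ln (real n) + c)" and ev: "even K" and r: "2 * r \<le> n"
  shows "(\<Sum>S\<in>Pow N. \<Sum>A\<in>{A. A \<subseteq> N \<and> card A = r}. (sector S (N - S) ^^ K) (point A) A)
      / (real n ^ 2) ^ K - 1
    \<le> 8 * exp (- c) * (2 * exp 1 * exp (4 * exp 1))"
proof -
  let ?t = "\<lambda>S. (\<Sum>A\<in>{A. A \<subseteq> N \<and> card A = r}. (sector S (N - S) ^^ K) (point A) A) / (real n ^ 2) ^ K"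
  let ?h = "\<lambda>s. real (min s (n - s) + 1) * sector_weight s (n - s)"
  have "(\<Sum>S\<in>Pow N. of_bool (S = {})) = (\<Sum>S\<in>Pow N. if {} = S then 1 else (0 :: real))"
    by (intro sum.cong) auto
  also have "\<dots> = 1" using fin by (subst sum.delta') auto
  finally have one: "(\<Sum>S\<in>Pow N. of_bool (S = {})) = (1 :: real)" .
  have "(\<Sum>S\<in>Pow N. \<Sum>A\<in>{A. A \<subseteq> N \<and> card A = r}. (sector S (N - S) ^^ K) (point A) A)
      / (real n ^ 2) ^ K - 1 = (\<Sum>S\<in>Pow N. ?t S - of_bool (S = {}))"
    unfolding sum_subtractf one by (simp only: sum_divide_distrib)
  also have "\<dots> \<le> (\<Sum>S\<in>Pow N. 8 * exp (- c) * ?h (card S))"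
  proof (rule sum_mono)
    fix S assume "S \<in> Pow N"
    then have S: "S \<subseteq> N" by auto
    have cS: "card (N - S) = n - card S" "card S \<le> n"
      using S fin by (auto simp: n_def card_Diff_subset finite_subset card_mono)
    have un: "S \<union> (N - S) = N" using S by auto
    have nn: "card S + card (N - S) = n" using cS by simp
    have "(\<Sum>A\<in>{A. A \<subseteq> S \<union> (N - S) \<and> card A = r}. (sector S (N - S) ^^ K) (point A) A)
        / (real (card S + card (N - S)) ^ 2) ^ K - of_bool (S = {})
      \<le> 8 * exp (- c) * (real (min (card S) (card (N - S)) + 1) * sector_weight (card S) (card (N - S)))"
      by (rule sector_trace_bound[OF _ _ _ _ c _ ev])
        (use S fin n K r nn finite_subset in auto)
    then show "?t S - of_bool (S = {}) \<le> 8 * exp (- c) * ?h (card S)"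
      unfolding un nn unfolding cS .
  qed
  also have "\<dots> = 8 * exp (- c) * (\<Sum>s\<le>n. real (n choose s) * ?h s)"
    using sum_Pow_card[OF fin, of ?h] by (simp only: sum_distrib_left[symmetric] n_def)
  also have "\<dots> \<le> 8 * exp (- c) * (2 * exp 1 * exp (4 * exp 1))"
    using n by (intro mult_left_mono sum_sector_weights_bound) auto
  finally show ?thesis .
qed

section \<open>Fourier analysis of the walk on configurations\<close>

text \<open>
  The character $(-1)^{|S \cap W|}$ of the group of subsets of \<open>N\<close> under symmetric difference.  Written as a product
  over \<open>N\<close> it is visibly symmetric and multiplicative.
\<close>
definition walsh :: "'a set \<Rightarrow> 'a set \<Rightarrow> 'a set \<Rightarrow> real" where
  "walsh N S W = (\<Prod>i\<in>N. if i \<in> S \<and> i \<in> W then - 1 else 1)"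

lemma walsh_commute: "walsh N S W = walsh N W S"
  unfolding walsh_def by (intro prod.cong) auto

lemma walsh_empty [simp]: "walsh N S {} = 1" "walsh N {} W = 1"
  by (simp_all add: walsh_def)

lemma walsh_sym_diff: "walsh N S (sym_diff W V) = walsh N S W * walsh N S V"
  unfolding walsh_def prod.distrib[symmetric] by (intro prod.cong) auto

lemma walsh_singleton:
  assumes "finite N" "a \<in> N"
  shows "walsh N S {a} = (if a \<in> S then - 1 else 1)"
proof -
  have "walsh N S {a} = (\<Prod>i\<in>N. if i = a then (if a \<in> S then - 1 else 1) else 1)"
    unfolding walsh_def by (intro prod.cong) auto
  then show ?thesis using assms by simp
qed

lemma sum_Pow_sym_diff:
  fixes f :: "'a set \<Rightarrow> real"
  assumes "V \<subseteq> N"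
  shows "(\<Sum>W\<in>Pow N. f (sym_diff W V)) = (\<Sum>W\<in>Pow N. f W)"
  by (rule sum.reindex_bij_witness[where i = "\<lambda>W. sym_diff W V" and j = "\<lambda>W. sym_diff W V"])
    (use assms in auto)

text \<open>Toggling one element of \<open>V\<close> in \<open>S\<close> changes the sign of every summand.\<close>
lemma walsh_orthogonality:
  assumes "finite N" "V \<subseteq> N"
  shows "(\<Sum>S\<in>Pow N. walsh N S V) = (if V = {} then 2 ^ card N else 0)"
proof (cases "V = {}")
  case True
  then show ?thesis using assms by (simp add: card_Pow)
next
  case False
  then obtain a where a: "a \<in> V" "a \<in> N" using assms by auto
  have "(\<Sum>S\<in>Pow N. walsh N S V) = (\<Sum>S\<in>Pow N. walsh N (sym_diff S {a}) V)"
    using a by (intro sum_Pow_sym_diff[symmetric]) auto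
  also have "\<dots> = - (\<Sum>S\<in>Pow N. walsh N S V)"
    unfolding walsh_commute[of N _ V] walsh_sym_diff walsh_singleton[OF assms(1) a(2)]
    using a by (simp add: sum_negf)
  finally show ?thesis using False by simp
qed

definition fourier :: "'a set \<Rightarrow> ('a set \<Rightarrow> real) \<Rightarrow> 'a set \<Rightarrow> real" where
  "fourier N f S = (\<Sum>W\<in>Pow N. walsh N S W * f W)"

lemma plancherel:
  assumes "finite N"
  shows "(\<Sum>S\<in>Pow N. fourier N f S ^ 2) = 2 ^ card N * (\<Sum>W\<in>Pow N. f W ^ 2)"
proof -
  have "(\<Sum>S\<in>Pow N. fourier N f S ^ 2)
     = (\<Sum>S\<in>Pow N. \<Sum>W\<in>Pow N. \<Sum>V\<in>Pow N. f W * f V * walsh N S (sym_diff W V))"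
    unfolding fourier_def power2_eq_square sum_product walsh_sym_diff
    by (intro sum.cong refl) (simp only: mult_ac)
  also have "\<dots> = (\<Sum>W\<in>Pow N. \<Sum>S\<in>Pow N. \<Sum>V\<in>Pow N. f W * f V * walsh N S (sym_diff W V))"
    by (rule sum.swap)
  also have "\<dots> = (\<Sum>W\<in>Pow N. \<Sum>V\<in>Pow N. f W * f V * (\<Sum>S\<in>Pow N. walsh N S (sym_diff W V)))"
    unfolding sum_distrib_left by (intro sum.cong refl sum.swap)
  also have "\<dots> = (\<Sum>W\<in>Pow N. \<Sum>V\<in>Pow N. if W = V then 2 ^ card N * f W ^ 2 else 0)"
  proof (intro sum.cong refl)
    fix W V assume "W \<in> Pow N" "V \<in> Pow N"
    then have sub: "sym_diff W V \<subseteq> N" by auto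
    have "sym_diff W V = {} \<longleftrightarrow> W = V" by auto
    then show "f W * f V * (\<Sum>S\<in>Pow N. walsh N S (sym_diff W V)) = (if W = V then 2 ^ card N * f W ^ 2 else 0)"
      unfolding walsh_orthogonality[OF assms sub] by (simp add: power2_eq_square)
  qed
  also have "\<dots> = (\<Sum>W\<in>Pow N. 2 ^ card N * f W ^ 2)"
    using assms by (intro sum.cong refl) simp
  finally show ?thesis by (simp only: sum_distrib_left)
qed

text \<open>
  The step as a backward recursion: every move is an involution, so the predecessors of a
  state are obtained by applying the moves to it.  For \<open>i = j\<close> the set \<open>{i, j}\<close> is a singleton, and the second
  summand is the flip of a single sign.
\<close>
primrec walk :: "'a set \<Rightarrow> 'a set \<Rightarrow> nat \<Rightarrow> 'a set \<Rightarrow> 'a set \<Rightarrow> real" where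
  "walk N B 0 = (\<lambda>W A. of_bool (W = {} \<and> A = B))"
| "walk N B (Suc k) = (\<lambda>W A. (\<Sum>i\<in>N. \<Sum>j\<in>N.
     walk N B k W (transpose i j ` A) + walk N B k (sym_diff W {i, j}) (transpose i j ` A))
     / (2 * real (card N) ^ 2))"

text \<open>
  Averaging over the coin that decides about the flip cancels exactly the pairs separated by \<open>S\<close> and the
  diagonal pairs in \<open>S\<close>.
\<close>
lemma walsh_pair:
  assumes "finite N" "i \<in> N" "j \<in> N"
  shows "1 + walsh N S {i, j} = 2 * (of_bool (i \<in> S \<and> j \<in> S) + of_bool (i \<notin> S \<and> j \<notin> S)
    - of_bool (i = j \<and> i \<in> S))"
proof (cases "i = j")
  case True
  then show ?thesis using walsh_singleton[OF assms(1,2)] by simp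
next
  case False
  then have "{i, j} = sym_diff {i} {j}" by auto
  then have "walsh N S {i, j} = walsh N S {i} * walsh N S {j}"
    using walsh_sym_diff by metis
  then show ?thesis using False
    unfolding walsh_singleton[OF assms(1,2)] walsh_singleton[OF assms(1,3)] by simp
qed

lemma sum_pairs_eq_sector:
  assumes "finite N" "S \<subseteq> N"
  shows "(\<Sum>i\<in>N. \<Sum>j\<in>N. (1 + walsh N S {i, j}) * h (transpose i j ` A)) = 2 * sector S (N - S) h A"
proof -
  have restrict: "(\<Sum>i\<in>N. \<Sum>j\<in>N. of_bool (i \<in> M \<and> j \<in> M) * f i j) = (\<Sum>i\<in>M. \<Sum>j\<in>M. f i j)"
    if "M \<subseteq> N" for M and f :: "'a \<Rightarrow> 'a \<Rightarrow> real"
  proof -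
    have "(\<Sum>i\<in>N. \<Sum>j\<in>N. of_bool (i \<in> M \<and> j \<in> M) * f i j) = (\<Sum>i\<in>M. \<Sum>j\<in>N. of_bool (i \<in> M \<and> j \<in> M) * f i j)"
      using that assms(1) by (intro sum.mono_neutral_right) auto
    also have "\<dots> = (\<Sum>i\<in>M. \<Sum>j\<in>M. of_bool (i \<in> M \<and> j \<in> M) * f i j)"
      using that assms(1) by (intro sum.cong refl sum.mono_neutral_right) auto
    finally show ?thesis by simp
  qed
  have r2: "(\<Sum>i\<in>N. \<Sum>j\<in>N. of_bool (i \<notin> S \<and> j \<notin> S) * f i j) = (\<Sum>i\<in>N - S. \<Sum>j\<in>N - S. f i j)"
    for f :: "'a \<Rightarrow> 'a \<Rightarrow> real"
    unfolding restrict[of "N - S", OF Diff_subset, symmetric] by (intro sum.cong refl) auto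
  have r3: "(\<Sum>i\<in>N. \<Sum>j\<in>N. of_bool (i = j \<and> i \<in> S) * h (transpose i j ` A)) = real (card S) * h A"
  proof -
    have "(\<Sum>i\<in>N. \<Sum>j\<in>N. of_bool (i = j \<and> i \<in> S) * h (transpose i j ` A))
       = (\<Sum>i\<in>N. \<Sum>j\<in>N. if i = j then of_bool (i \<in> S) * h A else 0)"
      by (intro sum.cong refl) auto
    also have "\<dots> = (\<Sum>i\<in>N. of_bool (i \<in> S) * h A)"
      using assms(1) by (intro sum.cong refl) simp
    also have "\<dots> = (\<Sum>i\<in>S. h A)"
      using assms by (intro sum.mono_neutral_cong_right) auto
    finally show ?thesis by simp
  qed
  have "(\<Sum>i\<in>N. \<Sum>j\<in>N. (1 + walsh N S {i, j}) * h (transpose i j ` A))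
     = (\<Sum>i\<in>N. \<Sum>j\<in>N. 2 * (of_bool (i \<in> S \<and> j \<in> S) * h (transpose i j ` A)
        + of_bool (i \<notin> S \<and> j \<notin> S) * h (transpose i j ` A)
        - of_bool (i = j \<and> i \<in> S) * h (transpose i j ` A)))"
    using assms(1) by (intro sum.cong refl) (simp only: walsh_pair algebra_simps)
  also have "\<dots> = 2 * ((\<Sum>i\<in>N. \<Sum>j\<in>N. of_bool (i \<in> S \<and> j \<in> S) * h (transpose i j ` A))
        + (\<Sum>i\<in>N. \<Sum>j\<in>N. of_bool (i \<notin> S \<and> j \<notin> S) * h (transpose i j ` A))
        - (\<Sum>i\<in>N. \<Sum>j\<in>N. of_bool (i = j \<and> i \<in> S) * h (transpose i j ` A)))"
    by (simp only: sum_distrib_left[symmetric] sum.distrib sum_subtractf)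
  finally show ?thesis
    unfolding restrict[OF assms(2)] r2 r3 sector_def exchange_def .
qed

text \<open>
  Toggling \<open>{i, j}\<close> multiplies the Fourier coefficient at \<open>S\<close> by a sign, and transpositions act on \<open>A\<close> alone; so
  different frequencies do not interact.
\<close>
lemma fourier_walk:
  assumes "finite N" "S \<subseteq> N"
  shows "fourier N (\<lambda>W. walk N B k W A) S
    = (sector S (N - S) ^^ k) (point B) A / (real (card N) ^ 2) ^ k"
proof (induction k arbitrary: A)
  case 0
  have "fourier N (\<lambda>W. walk N B 0 W A) S = (\<Sum>W\<in>Pow N. if W = {} then of_bool (A = B) else 0)"
    unfolding fourier_def by (intro sum.cong refl) auto
  then show ?case using assms(1) by (simp add: point_def)
next
  case (Suc k)
  let ?F = "\<lambda>A. fourier N (\<lambda>W. walk N B k W A) S"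
  let ?c = "2 * real (card N) ^ 2"
  have shift: "(\<Sum>W\<in>Pow N. walsh N S W * walk N B k (sym_diff W {i, j}) A) = walsh N S {i, j} * ?F A"
    if "i \<in> N" "j \<in> N" for i j A
  proof -
    have "(\<Sum>W\<in>Pow N. walsh N S W * walk N B k (sym_diff W {i, j}) A)
       = (\<Sum>W\<in>Pow N. walsh N S (sym_diff W {i, j}) * walk N B k (sym_diff (sym_diff W {i, j}) {i, j}) A)"
      using that by (intro sum_Pow_sym_diff[symmetric]) auto
    also have "\<dots> = (\<Sum>W\<in>Pow N. walsh N S {i, j} * (walsh N S W * walk N B k W A))"
    proof (intro sum.cong refl)
      fix W
      have "sym_diff (sym_diff W {i, j}) {i, j} = W" by auto
      then show "walsh N S (sym_diff W {i, j}) * walk N B k (sym_diff (sym_diff W {i, j}) {i, j}) A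
        = walsh N S {i, j} * (walsh N S W * walk N B k W A)"
        by (simp only: walsh_sym_diff mult_ac)
    qed
    finally show ?thesis by (simp only: fourier_def sum_distrib_left)
  qed
  have "fourier N (\<lambda>W. walk N B (Suc k) W A) S * ?c / ?c
    = (\<Sum>W\<in>Pow N. \<Sum>i\<in>N. \<Sum>j\<in>N. walsh N S W * walk N B k W (transpose i j ` A)
        + walsh N S W * walk N B k (sym_diff W {i, j}) (transpose i j ` A)) / ?c"
    unfolding fourier_def walk.simps times_divide_eq_right sum_divide_distrib[symmetric] sum_distrib_left
      distrib_left by simp
  also have "(\<Sum>W\<in>Pow N. \<Sum>i\<in>N. \<Sum>j\<in>N. walsh N S W * walk N B k W (transpose i j ` A)
        + walsh N S W * walk N B k (sym_diff W {i, j}) (transpose i j ` A))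
    = (\<Sum>i\<in>N. \<Sum>j\<in>N. \<Sum>W\<in>Pow N. walsh N S W * walk N B k W (transpose i j ` A)
        + walsh N S W * walk N B k (sym_diff W {i, j}) (transpose i j ` A))"
    by (subst sum.swap, rule sum.cong[OF refl], rule sum.swap)
  also have "\<dots> = (\<Sum>i\<in>N. \<Sum>j\<in>N. (1 + walsh N S {i, j}) * ?F (transpose i j ` A))"
  proof (intro sum.cong refl)
    fix i j assume "i \<in> N" "j \<in> N"
    show "(\<Sum>W\<in>Pow N. walsh N S W * walk N B k W (transpose i j ` A)
        + walsh N S W * walk N B k (sym_diff W {i, j}) (transpose i j ` A))
      = (1 + walsh N S {i, j}) * ?F (transpose i j ` A)"
      unfolding sum.distrib shift[OF \<open>i \<in> N\<close> \<open>j \<in> N\<close>]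
      by (simp only: fourier_def distrib_right mult_1)
  qed
  also have "\<dots> = 2 * sector S (N - S) ?F A"
    by (rule sum_pairs_eq_sector[OF assms])
  also have "?F = (\<lambda>A. (sector S (N - S) ^^ k) (point B) A / (real (card N) ^ 2) ^ k)"
    using Suc.IH by blast
  also have "sector S (N - S) (\<lambda>A. (sector S (N - S) ^^ k) (point B) A / (real (card N) ^ 2) ^ k) A
     = (sector S (N - S) ^^ Suc k) (point B) A / (real (card N) ^ 2) ^ k"
    by (simp add: sector_def exchange_def sum_divide_distrib add_divide_distrib diff_divide_distrib)
  \<comment> \<open>For \<open>n = 0\<close> both sides vanish because division by zero yields zero.\<close>
  finally show ?case using assms by (cases "card N = 0") (auto simp: fourier_def)
qed

abbreviation subsets_of_card :: "'a set \<Rightarrow> nat \<Rightarrow> 'a set set" where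
  "subsets_of_card N r \<equiv> {A. A \<subseteq> N \<and> card A = r}"

lemma permutes_image_subsets_of_card:
  assumes "p permutes N" "A \<in> subsets_of_card N r"
  shows "p ` A \<in> subsets_of_card N r"
  using assms permutes_image[OF assms(1)] by (auto simp: card_image permutes_inj_on)

lemma sum_subsets_transpose:
  fixes f :: "'a set \<Rightarrow> real"
  assumes "i \<in> N" "j \<in> N"
  shows "(\<Sum>A\<in>subsets_of_card N r. f (transpose i j ` A)) = (\<Sum>A\<in>subsets_of_card N r. f A)"
  by (rule sum.reindex_bij_witness[where i = "\<lambda>A. transpose i j ` A" and j = "\<lambda>A. transpose i j ` A"])
    (use assms permutes_image_subsets_of_card[OF permutes_swap_id, of i N j] in \<open>auto simp: image_comp\<close>)

lemma exchange_self_adjoint: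
  assumes "S \<subseteq> N"
  shows "(\<Sum>A\<in>subsets_of_card N r. exchange S f A * g A) = (\<Sum>A\<in>subsets_of_card N r. f A * exchange S g A)"
proof -
  let ?P = "subsets_of_card N r"
  have "(\<Sum>A\<in>?P. exchange S f A * g A) = (\<Sum>i\<in>S. \<Sum>A\<in>?P. \<Sum>j\<in>S. f (transpose i j ` A) * g A)"
    unfolding exchange_def sum_distrib_right by (rule sum.swap)
  also have "\<dots> = (\<Sum>i\<in>S. \<Sum>j\<in>S. \<Sum>A\<in>?P. f (transpose i j ` A) * g A)"
    by (intro sum.cong refl sum.swap)
  also have "\<dots> = (\<Sum>i\<in>S. \<Sum>j\<in>S. \<Sum>A\<in>?P. f A * g (transpose i j ` A))"
  proof (rule sum.cong[OF refl], rule sum.cong[OF refl])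
    fix i j assume "i \<in> S" "j \<in> S"
    then have ij: "i \<in> N" "j \<in> N" using assms by auto
    show "(\<Sum>A\<in>?P. f (transpose i j ` A) * g A) = (\<Sum>A\<in>?P. f A * g (transpose i j ` A))"
      using sum_subsets_transpose[OF ij, where r = r and f = "\<lambda>A. f A * g (transpose i j ` A)"]
      by (simp add: image_comp)
  qed
  also have "\<dots> = (\<Sum>i\<in>S. \<Sum>A\<in>?P. \<Sum>j\<in>S. f A * g (transpose i j ` A))"
    by (intro sum.cong refl sum.swap)
  also have "\<dots> = (\<Sum>A\<in>?P. f A * exchange S g A)"
    unfolding exchange_def sum_distrib_left by (rule sum.swap)
  finally show ?thesis .
qed

lemma sector_self_adjoint:
  assumes "S \<subseteq> N" "T \<subseteq> N"
  shows "(\<Sum>A\<in>subsets_of_card N r. sector S T f A * g A) = (\<Sum>A\<in>subsets_of_card N r. f A * sector S T g A)"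
proof -
  have "(\<Sum>A\<in>subsets_of_card N r. sector S T f A * g A)
    = (\<Sum>A\<in>subsets_of_card N r. exchange S f A * g A) + (\<Sum>A\<in>subsets_of_card N r. exchange T f A * g A)
      - (\<Sum>A\<in>subsets_of_card N r. real (card S) * (f A * g A))"
    unfolding sum.distrib[symmetric] sum_subtractf[symmetric]
    by (intro sum.cong refl) (simp add: sector_def algebra_simps)
  also have "\<dots> = (\<Sum>A\<in>subsets_of_card N r. f A * sector S T g A)"
    unfolding exchange_self_adjoint[OF assms(1)] exchange_self_adjoint[OF assms(2)]
    unfolding sum.distrib[symmetric] sum_subtractf[symmetric]
    by (intro sum.cong refl) (simp add: sector_def algebra_simps)
  finally show ?thesis .
qed

text \<open>
  Self-adjointness moves one of the two factors of the square to the other side, which leaves a diagonal entry of the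
  doubled power.
\<close>
lemma sum_square_sector_pow:
  assumes "finite N" "S \<subseteq> N" "T \<subseteq> N" "B \<in> subsets_of_card N r"
  shows "(\<Sum>A\<in>subsets_of_card N r. ((sector S T ^^ k) (point B) A) ^ 2) = (sector S T ^^ (2 * k)) (point B) B"
proof -
  have adj: "(\<Sum>A\<in>subsets_of_card N r. (sector S T ^^ k) f A * g A)
     = (\<Sum>A\<in>subsets_of_card N r. f A * (sector S T ^^ k) g A)" for k f g
  proof (induction k arbitrary: g)
    case (Suc k)
    have "(\<Sum>A\<in>subsets_of_card N r. sector S T ((sector S T ^^ k) f) A * g A)
       = (\<Sum>A\<in>subsets_of_card N r. (sector S T ^^ k) f A * sector S T g A)"
      by (rule sector_self_adjoint[OF assms(2,3)])
    also have "\<dots> = (\<Sum>A\<in>subsets_of_card N r. f A * (sector S T ^^ k) (sector S T g) A)"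
      by (rule Suc.IH)
    finally show ?case by (simp add: funpow_swap1)
  qed simp
  have "(\<Sum>A\<in>subsets_of_card N r. ((sector S T ^^ k) (point B) A) ^ 2)
     = (\<Sum>A\<in>subsets_of_card N r. point B A * (sector S T ^^ (2 * k)) (point B) A)"
    unfolding power2_eq_square adj mult_2 funpow_add by simp
  also have "\<dots> = (\<Sum>A\<in>subsets_of_card N r. if A = B then (sector S T ^^ (2 * k)) (point B) B else 0)"
    by (intro sum.cong refl) (simp add: point_def)
  also have "\<dots> = (sector S T ^^ (2 * k)) (point B) B"
    using assms(1,4) by (subst sum.delta) auto
  finally show ?thesis .
qed

lemma transpose_image_conj:
  assumes "inj p"
  shows "p ` transpose i j ` A = transpose (p i) (p j) ` p ` A"
proof -
  have "p (transpose i j x) = transpose (p i) (p j) (p x)" for x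
    using assms by (auto simp: transpose_def inj_eq)
  then show ?thesis by (simp add: image_image)
qed

lemma sector_pow_image:
  assumes "inj p"
  shows "(sector (p ` S) (p ` T) ^^ k) h (p ` A) = (sector S T ^^ k) (\<lambda>A. h (p ` A)) A"
proof (induction k arbitrary: A)
  case (Suc k)
  have ex: "exchange (p ` V) g (p ` A) = exchange V (\<lambda>A. g (p ` A)) A" for V and g :: "'b set \<Rightarrow> real"
    unfolding exchange_def using assms
    by (simp add: sum.reindex inj_on_subset[OF assms] transpose_image_conj)
  have "card (p ` S) = card S" using assms by (simp add: card_image inj_on_subset)
  then show ?case using Suc.IH by (simp add: sector_def ex)
qed simp

lemma ex_permutes_image:
  assumes "finite N" "A \<in> subsets_of_card N r" "B \<in> subsets_of_card N r"
  shows "\<exists>p. p permutes N \<and> p ` B = A"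
proof -
  have fin: "finite A" "finite B" using assms finite_subset by auto
  obtain f where f: "bij_betw f B A"
    using finite_same_card_bij[OF fin(2,1)] assms by auto
  obtain g where g: "bij_betw g (N - B) (N - A)"
    using finite_same_card_bij[of "N - B" "N - A"] assms fin by (auto simp: card_Diff_subset)
  define p where "p x = (if x \<in> B then f x else if x \<in> N then g x else x)" for x
  have pB: "bij_betw p B A" using f by (subst bij_betw_cong[of _ _ f]) (auto simp: p_def)
  have "bij_betw p (N - B) (N - A)" using g by (subst bij_betw_cong[of _ _ g]) (auto simp: p_def)
  then have "bij_betw p (B \<union> (N - B)) (A \<union> (N - A))" using pB by (intro bij_betw_combine) auto
  moreover have "B \<union> (N - B) = N" "A \<union> (N - A) = N" using assms by auto
  ultimately have "p permutes N"
    using assms by (intro bij_imp_permutes) (auto simp: p_def)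
  then show ?thesis using pB by (auto simp: bij_betw_def)
qed

text \<open>
  A permutation \<open>p\<close> of \<open>N\<close> with \<open>p ` B = A\<close> conjugates the operator for \<open>S\<close> into the operator for
  \<open>p ` S\<close>.  Only the sum over all frequencies is invariant, which is enough to replace a diagonal entry by an
  average, that is, by a trace.
\<close>
lemma sum_sector_return_const:
  assumes "finite N" "A \<in> subsets_of_card N r" "B \<in> subsets_of_card N r"
  shows "(\<Sum>S\<in>Pow N. (sector S (N - S) ^^ k) (point A) A) = (\<Sum>S\<in>Pow N. (sector S (N - S) ^^ k) (point B) B)"
proof -
  obtain p where p: "p permutes N" "p ` B = A" using ex_permutes_image[OF assms] by auto
  have inj: "inj p" using p(1) permutes_inj by blast
  have pN: "p ` N = N" using p(1) permutes_image by blast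
  have "(\<lambda>C. point (p ` B) (p ` C)) = point B"
    using inj by (auto simp: point_def inj_image_eq_iff)
  then have eq: "(sector (p ` S) (N - p ` S) ^^ k) (point A) A = (sector S (N - S) ^^ k) (point B) B" for S
    using sector_pow_image[OF inj,
        where S = S and T = "N - S" and k = k and h = "point (p ` B)" and A = B] p(2) pN inj
    by (simp add: image_set_diff)
  have "bij_betw ((`) p) (Pow N) (Pow N)"
    using bij_betw_Pow[of p N N] p(1) permutes_imp_bij by blast
  then have "(\<Sum>S\<in>Pow N. (sector S (N - S) ^^ k) (point A) A)
     = (\<Sum>S\<in>Pow N. (sector (p ` S) (N - p ` S) ^^ k) (point A) A)"
    by (rule sum.reindex_bij_betw[symmetric])
  then show ?thesis using eq by simp
qed

lemma walk_total_mass: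
  assumes "finite N" "N \<noteq> {}" "B \<in> subsets_of_card N r"
  shows "(\<Sum>A\<in>subsets_of_card N r. \<Sum>W\<in>Pow N. walk N B k W A) = 1"
proof -
  let ?P = "subsets_of_card N r"
  have n: "real (card N) \<noteq> 0" using assms by simp
  have "(\<Sum>A\<in>?P. (sector {} N ^^ k) (point B) A) = (real (card N) ^ 2) ^ k"
  proof (induction k)
    case 0
    have "(\<Sum>A\<in>?P. point B A) = (\<Sum>A\<in>?P. if A = B then 1 else 0)"
      by (intro sum.cong refl) (simp add: point_def)
    then show ?case using assms by (simp add: sum.delta)
  next
    case (Suc k)
    have "(\<Sum>A\<in>?P. (sector {} N ^^ Suc k) (point B) A)
       = (\<Sum>A\<in>?P. exchange N ((sector {} N ^^ k) (point B)) A * 1)"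
      by (simp add: sector_def exchange_def)
    also have "\<dots> = (\<Sum>A\<in>?P. (sector {} N ^^ k) (point B) A * exchange N (\<lambda>_. 1) A)"
      by (rule exchange_self_adjoint[where S = N and g = "\<lambda>_. 1"]) simp
    also have "\<dots> = (\<Sum>A\<in>?P. (sector {} N ^^ k) (point B) A) * real (card N) ^ 2"
      unfolding sum_distrib_right by (simp add: exchange_def power2_eq_square)
    finally show ?case using Suc by simp
  qed
  moreover have "(\<Sum>W\<in>Pow N. walk N B k W A) = (sector {} N ^^ k) (point B) A / (real (card N) ^ 2) ^ k" for A
    using fourier_walk[OF assms(1), of "{}" B k A] by (simp add: fourier_def)
  ultimately show ?thesis using n by (simp add: sum_divide_distrib[symmetric])
qed

text \<open>
  Expanding the square leaves \<open>M\<close> times the sum of squares minus one, since the walk is a probability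
  distribution.  Plancherel, \<open>sum_square_sector_pow\<close> and averaging over the starting set turn this sum into
  traces.
\<close>
lemma walk_l2_eq_trace:
  assumes "finite N" "N \<noteq> {}" "B \<in> subsets_of_card N r"
  defines "M \<equiv> 2 ^ card N * real (card N choose r)"
  shows "M * (\<Sum>A\<in>subsets_of_card N r. \<Sum>W\<in>Pow N. (walk N B k W A - 1 / M) ^ 2)
    = (\<Sum>S\<in>Pow N. \<Sum>A\<in>subsets_of_card N r. (sector S (N - S) ^^ (2 * k)) (point A) A)
      / (real (card N) ^ 2) ^ (2 * k) - 1"
proof -
  let ?P = "subsets_of_card N r"
  have cP: "card ?P = card N choose r" using n_subsets[OF assms(1)] .
  have "card B \<le> card N" using assms by (auto intro: card_mono)
  then have "0 < card N choose r" using assms(3) by (simp add: zero_less_binomial)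
  then have M: "0 < M" by (simp add: M_def)
  have cM: "(\<Sum>A\<in>?P. \<Sum>W\<in>Pow N. x) = M * x" for x :: real
    using assms(1) by (simp add: cP M_def card_Pow)
  have "(\<Sum>A\<in>?P. \<Sum>W\<in>Pow N. (walk N B k W A - 1 / M) ^ 2)
    = (\<Sum>A\<in>?P. \<Sum>W\<in>Pow N. walk N B k W A ^ 2) - 2 / M * (\<Sum>A\<in>?P. \<Sum>W\<in>Pow N. walk N B k W A)
      + (\<Sum>A\<in>?P. \<Sum>W\<in>Pow N. (1 / M) ^ 2)"
    unfolding sum_distrib_left sum_subtractf[symmetric] sum.distrib[symmetric]
    by (intro sum.cong refl) (simp add: power2_eq_square algebra_simps)
  also have "\<dots> = (\<Sum>A\<in>?P. \<Sum>W\<in>Pow N. walk N B k W A ^ 2) - 1 / M"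
    unfolding walk_total_mass[OF assms(1-3)] cM using M by (simp add: field_simps power2_eq_square)
  finally have "M * (\<Sum>A\<in>?P. \<Sum>W\<in>Pow N. (walk N B k W A - 1 / M) ^ 2)
    = M * (\<Sum>A\<in>?P. \<Sum>W\<in>Pow N. walk N B k W A ^ 2) - 1"
    using M by (simp add: field_simps)
  also have "M * (\<Sum>A\<in>?P. \<Sum>W\<in>Pow N. walk N B k W A ^ 2)
    = real (card ?P) * (\<Sum>A\<in>?P. \<Sum>S\<in>Pow N. fourier N (\<lambda>W. walk N B k W A) S ^ 2)"
    unfolding plancherel[OF assms(1)] sum_distrib_left[symmetric] cP M_def by (simp only: mult_ac)
  also have "(\<Sum>A\<in>?P. \<Sum>S\<in>Pow N. fourier N (\<lambda>W. walk N B k W A) S ^ 2)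
    = (\<Sum>S\<in>Pow N. \<Sum>A\<in>?P. fourier N (\<lambda>W. walk N B k W A) S ^ 2)"
    by (rule sum.swap)
  also have "\<dots> = (\<Sum>S\<in>Pow N. (sector S (N - S) ^^ (2 * k)) (point B) B) / (real (card N) ^ 2) ^ (2 * k)"
    unfolding sum_divide_distrib
  proof (rule sum.cong[OF refl])
    fix S assume "S \<in> Pow N"
    then have S: "S \<subseteq> N" by simp
    have "(\<Sum>A\<in>?P. fourier N (\<lambda>W. walk N B k W A) S ^ 2)
      = (\<Sum>A\<in>?P. ((sector S (N - S) ^^ k) (point B) A) ^ 2) / (real (card N) ^ 2) ^ (2 * k)"
      unfolding fourier_walk[OF assms(1) S] sum_divide_distrib
      by (simp add: power_divide power_mult power2_eq_square power_mult_distrib mult_2 power_add)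
    then show "(\<Sum>A\<in>?P. fourier N (\<lambda>W. walk N B k W A) S ^ 2)
      = (sector S (N - S) ^^ (2 * k)) (point B) B / (real (card N) ^ 2) ^ (2 * k)"
      unfolding sum_square_sector_pow[OF assms(1) S Diff_subset assms(3)] .
  qed
  also have "real (card ?P) * ((\<Sum>S\<in>Pow N. (sector S (N - S) ^^ (2 * k)) (point B) B) / (real (card N) ^ 2) ^ (2 * k))
    = (\<Sum>A\<in>?P. \<Sum>S\<in>Pow N. (sector S (N - S) ^^ (2 * k)) (point A) A) / (real (card N) ^ 2) ^ (2 * k)"
  proof -
    have "(\<Sum>A\<in>?P. \<Sum>S\<in>Pow N. (sector S (N - S) ^^ (2 * k)) (point A) A)
      = (\<Sum>A\<in>?P. \<Sum>S\<in>Pow N. (sector S (N - S) ^^ (2 * k)) (point B) B)"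
      by (rule sum.cong[OF refl]) (rule sum_sector_return_const[OF assms(1) _ assms(3)])
    then show ?thesis by simp
  qed
  also have "(\<Sum>A\<in>?P. \<Sum>S\<in>Pow N. (sector S (N - S) ^^ (2 * k)) (point A) A)
    = (\<Sum>S\<in>Pow N. \<Sum>A\<in>?P. (sector S (N - S) ^^ (2 * k)) (point A) A)"
    by (rule sum.swap)
  finally show ?thesis .
qed

section \<open>Cosets in the hyperoctahedral group as configurations\<close>

definition supp :: "(nat \<Rightarrow> bit) \<Rightarrow> nat set" where
  "supp v = {i. v i \<noteq> 0}"

lemma supp_eq_iff: "supp v = supp w \<longleftrightarrow> v = w"
proof
  assume "supp v = supp w"
  then have "v i \<noteq> 0 \<longleftrightarrow> w i \<noteq> 0" for i by (auto simp: supp_def)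
  then have "v i = w i" for i by (cases "v i"; cases "w i") (metis bit_not_zero_iff)+
  then show "v = w" by blast
qed simp

lemma supp_of_set: "supp (\<lambda>l. if l \<in> W then 1 else 0) = W"
  by (auto simp: supp_def)

lemma supp_add: "supp (\<lambda>i. v i + w i) = sym_diff (supp v) (supp w)"
proof -
  have "a + b \<noteq> 0 \<longleftrightarrow> (a \<noteq> 0) \<noteq> (b \<noteq> 0)" for a b :: bit
    by (cases a; cases b) auto
  then show ?thesis by (auto simp: supp_def)
qed

lemma bit_vectors_iff_supp: "v \<in> bit_vectors n \<longleftrightarrow> supp v \<subseteq> {1..n}"
  by (auto simp: bit_vectors_def supp_def)

fun config :: "nat \<Rightarrow> signed_perm \<Rightarrow> nat set \<times> nat set" where
  "config r (v, p) = (supp v, p ` {1..r})"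

definition configs :: "nat \<Rightarrow> nat \<Rightarrow> (nat set \<times> nat set) set" where
  "configs n r = Pow {1..n} \<times> subsets_of_card {1..n} r"

definition fibre :: "nat \<Rightarrow> nat \<Rightarrow> nat set \<times> nat set \<Rightarrow> signed_perm set" where
  "fibre n r y = {g \<in> carrier (hyperoct n). config r g = y}"

lemma hyperoct_carrier_iff:
  "(v, p) \<in> carrier (hyperoct n) \<longleftrightarrow> supp v \<subseteq> {1..n} \<and> p permutes {1..n}"
  by (auto simp: hyperoct_def bit_vectors_iff_supp)

lemma hyperoct_mult:
  "(v, p) \<otimes>\<^bsub>hyperoct n\<^esub> (w, q) = (\<lambda>i. v i + w (inv_into UNIV p i), p \<circ> q)"
  by (simp add: hyperoct_def)

lemma hyperoct_inv:
  assumes "(v, p) \<in> carrier (hyperoct n)"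
  shows "inv\<^bsub>hyperoct n\<^esub> (v, p) = (\<lambda>i. v (p i), inv_into UNIV p)"
proof -
  interpret group "hyperoct n" by (rule hyperoct_group)
  have p: "p permutes {1..n}" and v: "supp v \<subseteq> {1..n}"
    using assms by (auto simp: hyperoct_carrier_iff)
  show ?thesis
  proof (rule inv_equality)
    show "(\<lambda>i. v (p i), inv_into UNIV p) \<otimes>\<^bsub>hyperoct n\<^esub> (v, p) = \<one>\<^bsub>hyperoct n\<^esub>"
      using p by (simp add: hyperoct_def inv_inv_eq permutes_bij permutes_inv_o fun_eq_iff
          flip: bit_not_zero_iff)
    have "supp (\<lambda>i. v (p i)) \<subseteq> {1..n}"
      using v permutes_in_image[OF p] by (fastforce simp: supp_def)
    then show "(\<lambda>i. v (p i), inv_into UNIV p) \<in> carrier (hyperoct n)"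
      using p by (simp add: hyperoct_carrier_iff permutes_inv)
  qed (rule assms)
qed

lemma young_iff:
  assumes "r \<le> n"
  shows "(v, p) \<in> young n r \<longleftrightarrow> supp v = {} \<and> p permutes {1..n} \<and> p ` {1..r} = {1..r}"
proof -
  have "p ` {r + 1..n} = {r + 1..n}" if "p permutes {1..n}" "p ` {1..r} = {1..r}"
  proof -
    have "{r + 1..n} = {1..n} - {1..r}" using assms by auto
    then show ?thesis
      using that permutes_inj[OF that(1)] permutes_image[OF that(1)] by (simp add: image_set_diff)
  qed
  then show ?thesis
    using supp_eq_iff[of v "\<lambda>_. 0"] by (auto simp: young_def young_perms_def supp_def)
qed

lemma config_in_configs:
  assumes "r \<le> n" "g \<in> carrier (hyperoct n)"
  shows "config r g \<in> configs n r"
proof (cases g)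
  case (Pair v p)
  then have "p permutes {1..n}" "supp v \<subseteq> {1..n}" using assms by (auto simp: hyperoct_carrier_iff)
  then show ?thesis
    using Pair assms(1) permutes_image_subsets_of_card[of p "{1..n}" "{1..r}" r]
    by (auto simp: configs_def)
qed

lemma fibre_nonempty:
  assumes "r \<le> n" "y \<in> configs n r"
  shows "fibre n r y \<noteq> {}"
proof -
  obtain W A where y: "y = (W, A)" "W \<subseteq> {1..n}" "A \<in> subsets_of_card {1..n} r"
    using assms(2) by (auto simp: configs_def)
  obtain p where "p permutes {1..n}" "p ` {1..r} = A"
    using ex_permutes_image[OF _ y(3), of "{1..r}"] assms(1) by auto
  then have "(\<lambda>l. if l \<in> W then 1 else 0, p) \<in> fibre n r y"
    using y by (simp add: fibre_def hyperoct_carrier_iff supp_of_set)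
  then show ?thesis by blast
qed

text \<open>
  Right multiplication by an element of the subgroup leaves the sign vector alone and precomposes the permutation
  with one that preserves \<open>{1..r}\<close>.  Hence \<open>config r\<close> is a complete invariant of left cosets.
\<close>
lemma l_coset_eq_fibre:
  assumes r: "r \<le> n" and x: "x \<in> carrier (hyperoct n)"
  shows "x <#\<^bsub>hyperoct n\<^esub> young n r = fibre n r (config r x)"
proof (cases x)
  case (Pair v p)
  have p: "p permutes {1..n}" and v: "supp v \<subseteq> {1..n}"
    using x Pair by (auto simp: hyperoct_carrier_iff)
  have mult: "(v, p) \<otimes>\<^bsub>hyperoct n\<^esub> (\<lambda>_. 0, k) = (v, p \<circ> k)" for k
    by (simp add: hyperoct_mult del: add_bit_eq_xor)
  show ?thesis
  proof (intro equalityI subsetI)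
    fix g assume "g \<in> x <#\<^bsub>hyperoct n\<^esub> young n r"
    then obtain k where k: "k \<in> young n r" "g = (v, p) \<otimes>\<^bsub>hyperoct n\<^esub> k"
      by (auto simp: l_coset_def Pair)
    obtain q where q: "k = (\<lambda>_. 0, q)" using k(1) by (auto simp: young_def)
    then have "q permutes {1..n}" "q ` {1..r} = {1..r}" using k(1) young_iff[OF r] by auto
    then have "(p \<circ> q) ` {1..r} = p ` {1..r}" "p \<circ> q permutes {1..n}"
      using p by (auto simp: image_comp[symmetric] simp del: o_apply intro: permutes_compose)
    then show "g \<in> fibre n r (config r x)"
      using v by (simp add: fibre_def k(2) q mult hyperoct_carrier_iff Pair)
  next
    fix g assume g: "g \<in> fibre n r (config r x)"
    then obtain q where gq: "g = (v, q)" "q permutes {1..n}" "q ` {1..r} = p ` {1..r}"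
      by (cases g) (auto simp: fibre_def Pair supp_eq_iff hyperoct_carrier_iff)
    have "(inv_into UNIV p \<circ> q) ` {1..r} = inv_into UNIV p ` p ` {1..r}"
      using gq(3) by (simp only: image_comp[symmetric])
    also have "\<dots> = {1..r}" using permutes_inv_o(2)[OF p] by (simp only: image_comp image_id id_apply)
    finally have "(\<lambda>_. 0, inv_into UNIV p \<circ> q) \<in> young n r"
      using p gq(2) by (simp add: young_iff[OF r] permutes_compose permutes_inv supp_def)
    moreover have "g = (v, p) \<otimes>\<^bsub>hyperoct n\<^esub> (\<lambda>_. 0, inv_into UNIV p \<circ> q)"
      unfolding mult gq(1) using permutes_inv_o(1)[OF p] by (simp add: comp_assoc[symmetric])
    ultimately show "g \<in> x <#\<^bsub>hyperoct n\<^esub> young n r"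
      unfolding l_coset_def Pair by blast
  qed
qed

lemma finite_configs: "finite (configs n r)"
  by (auto simp: configs_def)

lemma card_configs: "card (configs n r) = 2 ^ n * (n choose r)"
  using n_subsets[of "{1..n}" r] by (simp add: configs_def card_cartesian_product card_Pow)

lemma bij_betw_fibre:
  assumes "r \<le> n"
  shows "bij_betw (fibre n r) (configs n r) (cosets n r)"
proof -
  have "inj_on (fibre n r) (configs n r)"
  proof (rule inj_onI)
    fix y z assume "y \<in> configs n r" "fibre n r y = fibre n r z"
    then show "y = z" using fibre_nonempty[OF assms, of y] by (auto simp: fibre_def)
  qed
  moreover have "fibre n r ` configs n r = cosets n r"
  proof (intro equalityI subsetI)
    fix C assume "C \<in> fibre n r ` configs n r"
    then obtain y where y: "y \<in> configs n r" "C = fibre n r y" by auto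
    then obtain x where "x \<in> fibre n r y" using fibre_nonempty[OF assms] by blast
    then have "x \<in> carrier (hyperoct n)" "config r x = y" by (auto simp: fibre_def)
    then show "C \<in> cosets n r"
      using l_coset_eq_fibre[OF assms, of x] y by (auto simp: cosets_def LCOSETS_def)
  next
    fix C assume "C \<in> cosets n r"
    then obtain x where "x \<in> carrier (hyperoct n)" "C = x <#\<^bsub>hyperoct n\<^esub> young n r"
      by (auto simp: cosets_def LCOSETS_def)
    then show "C \<in> fibre n r ` configs n r"
      using l_coset_eq_fibre[OF assms] config_in_configs[OF assms] by auto
  qed
  ultimately show ?thesis by (simp add: bij_betw_def)
qed

lemma finite_hyperoct: "finite (carrier (hyperoct n))"
  and card_hyperoct: "card (carrier (hyperoct n)) = 2 ^ n * fact n"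
proof -
  have bij: "bij_betw supp (bit_vectors n) (Pow {1..n})"
    unfolding bij_betw_def
  proof (intro conjI inj_onI equalityI subsetI)
    fix W assume "W \<in> Pow {1..n}"
    then have "(\<lambda>l. if l \<in> W then 1 else 0) \<in> bit_vectors n" "W = supp (\<lambda>l. if l \<in> W then 1 else 0)"
      by (simp_all only: bit_vectors_iff_supp supp_of_set Pow_iff)
    then show "W \<in> supp ` bit_vectors n" by blast
  qed (simp_all only: supp_eq_iff, auto simp only: bit_vectors_iff_supp)
  have "finite (bit_vectors n)" using bij_betw_finite[OF bij] by simp
  moreover have "card (bit_vectors n) = 2 ^ n" using bij_betw_same_card[OF bij] by (simp add: card_Pow)
  ultimately show "finite (carrier (hyperoct n))" "card (carrier (hyperoct n)) = 2 ^ n * fact n"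
    by (simp_all add: hyperoct_def finite_permutations card_cartesian_product card_permutations)
qed

text \<open>
  All fibres have the size of the subgroup, by translation.  As they partition the group, that size is
  $2^n n!$ divided by the number $2^n \binom{n}{r}$ of fibres.
\<close>
lemma card_fibre:
  assumes r: "r \<le> n" and y: "y \<in> configs n r"
  shows "card (fibre n r y) = fact r * fact (n - r)"
proof -
  interpret group "hyperoct n" by (rule hyperoct_group)
  have const: "card (fibre n r z) = card (young n r)" if z: "z \<in> configs n r" for z
  proof -
    obtain x where x: "x \<in> carrier (hyperoct n)" "config r x = z"
      using fibre_nonempty[OF r z] by (auto simp: fibre_def)
    have "x <#\<^bsub>hyperoct n\<^esub> young n r = (\<lambda>k. x \<otimes>\<^bsub>hyperoct n\<^esub> k) ` young n r"
      by (auto simp: l_coset_def)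
    moreover have "inj_on (\<lambda>k. x \<otimes>\<^bsub>hyperoct n\<^esub> k) (young n r)"
      using x subgroup.subset[OF young_subgroup, of n r] by (auto intro!: inj_onI simp: subset_iff)
    ultimately show ?thesis
      using l_coset_eq_fibre[OF r x(1)] x(2) by (metis card_image)
  qed
  have "carrier (hyperoct n) = (\<Union>z\<in>configs n r. fibre n r z)"
    using config_in_configs[OF r] by (auto simp: fibre_def)
  then have "card (carrier (hyperoct n)) = (\<Sum>z\<in>configs n r. card (fibre n r z))"
    by (simp only:) (rule card_UN_disjoint, auto simp: finite_configs fibre_def finite_hyperoct)
  then have "2 ^ n * fact n = 2 ^ n * (n choose r) * card (young n r)"
    by (simp add: const card_hyperoct card_configs)
  then have "fact n = (n choose r) * card (young n r)" by simp
  then have "(n choose r) * (fact r * fact (n - r)) = (n choose r) * card (young n r)"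
    using binomial_fact_lemma[OF r] by (simp add: mult_ac)
  then show ?thesis using const[OF y] r by (simp add: zero_less_binomial_iff)
qed

text \<open>
  The powers are defined by multiplying a new increment on the left.  On left cosets a walk with increments
  on the right is the convenient one; the two agree because convolution is associative.
\<close>
lemma convolution_power_Suc_right:
  assumes "group G" "finite (carrier G)" "g \<in> carrier G"
  shows "convolution_power G R (Suc k) g
    = (\<Sum>h\<in>carrier G. convolution_power G R k h * R (inv\<^bsub>G\<^esub> h \<otimes>\<^bsub>G\<^esub> g))"
  using assms(3)
proof (induction k arbitrary: g)
  case 0
  interpret group G by fact
  have "convolution_power G R (Suc 0) g = (\<Sum>h\<in>carrier G. if h = \<one>\<^bsub>G\<^esub> then R g else 0)"
    using 0 by (auto simp: convolution_def intro!: sum.cong)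
  also have "\<dots> = (\<Sum>h\<in>carrier G. convolution_power G R 0 h * R (inv\<^bsub>G\<^esub> h \<otimes>\<^bsub>G\<^esub> g))"
    using 0 by (auto intro!: sum.cong)
  finally show ?case .
next
  case (Suc k)
  interpret group G by fact
  let ?p = "convolution_power G R k"
  have "convolution_power G R (Suc (Suc k)) g
    = (\<Sum>h\<in>carrier G. R (g \<otimes>\<^bsub>G\<^esub> inv\<^bsub>G\<^esub> h) * (\<Sum>u\<in>carrier G. ?p u * R (inv\<^bsub>G\<^esub> u \<otimes>\<^bsub>G\<^esub> h)))"
    unfolding convolution_power.simps(2)[of G R "Suc k"] convolution_def[of G R "convolution_power G R (Suc k)"]
    by (intro sum.cong refl) (simp only: Suc.IH)
  also have "\<dots> = (\<Sum>u\<in>carrier G. \<Sum>h\<in>carrier G.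
      ?p u * (R (g \<otimes>\<^bsub>G\<^esub> inv\<^bsub>G\<^esub> h) * R (inv\<^bsub>G\<^esub> u \<otimes>\<^bsub>G\<^esub> h)))"
    unfolding sum_distrib_left by (subst sum.swap) (simp only: mult_ac)
  also have "\<dots> = (\<Sum>u\<in>carrier G. \<Sum>h\<in>carrier G.
      ?p u * (R (h \<otimes>\<^bsub>G\<^esub> inv\<^bsub>G\<^esub> u) * R (inv\<^bsub>G\<^esub> h \<otimes>\<^bsub>G\<^esub> g)))"
  proof (rule sum.cong[OF refl])
    fix u assume u: "u \<in> carrier G"
    have cancel: "x \<otimes>\<^bsub>G\<^esub> (inv\<^bsub>G\<^esub> x \<otimes>\<^bsub>G\<^esub> y) = y"
      if "x \<in> carrier G" "y \<in> carrier G" for x y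
      using that by (simp add: m_assoc[symmetric])
    show "(\<Sum>h\<in>carrier G. ?p u * (R (g \<otimes>\<^bsub>G\<^esub> inv\<^bsub>G\<^esub> h) * R (inv\<^bsub>G\<^esub> u \<otimes>\<^bsub>G\<^esub> h)))
      = (\<Sum>h\<in>carrier G. ?p u * (R (h \<otimes>\<^bsub>G\<^esub> inv\<^bsub>G\<^esub> u) * R (inv\<^bsub>G\<^esub> h \<otimes>\<^bsub>G\<^esub> g)))"
      by (rule sum.reindex_bij_witness[where i = "\<lambda>h. u \<otimes>\<^bsub>G\<^esub> (inv\<^bsub>G\<^esub> h \<otimes>\<^bsub>G\<^esub> g)"
            and j = "\<lambda>h. g \<otimes>\<^bsub>G\<^esub> (inv\<^bsub>G\<^esub> h \<otimes>\<^bsub>G\<^esub> u)"])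
        (use u Suc.prems in \<open>simp_all add: inv_mult_group m_assoc cancel\<close>)
  qed
  also have "\<dots> = (\<Sum>h\<in>carrier G. convolution_power G R (Suc k) h * R (inv\<^bsub>G\<^esub> h \<otimes>\<^bsub>G\<^esub> g))"
    unfolding convolution_power.simps(2) convolution_def sum_distrib_right
    by (subst sum.swap) (simp only: mult_ac)
  finally show ?case .
qed

section \<open>The measure as a step of the walk\<close>

lemma young_iff_config:
  assumes "r \<le> n" "g \<in> carrier (hyperoct n)"
  shows "g \<in> young n r \<longleftrightarrow> config r g = ({}, {1..r})"
  using assms by (cases g) (auto simp: young_iff hyperoct_carrier_iff simp del: image_is_empty)

lemma mem_set_mult_young_iff:
  assumes "r \<le> n" "X \<subseteq> carrier (hyperoct n)" "g \<in> carrier (hyperoct n)"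
  shows "g \<in> X <#>\<^bsub>hyperoct n\<^esub> young n r \<longleftrightarrow> (\<exists>x\<in>X. config r x = config r g)"
proof -
  have "X <#>\<^bsub>hyperoct n\<^esub> young n r = (\<Union>x\<in>X. x <#\<^bsub>hyperoct n\<^esub> young n r)"
    by (auto simp: set_mult_def l_coset_def)
  also have "\<dots> = (\<Union>x\<in>X. fibre n r (config r x))"
    using assms(2) by (intro SUP_cong refl l_coset_eq_fibre assms(1)) auto
  finally show ?thesis using assms(3) unfolding fibre_def by (simp only: UN_iff mem_Collect_eq) metis
qed

lemma supp_signs:
  "supp (\<lambda>l. if l = i then 1 else 0) = {i}"
  "supp (\<lambda>l. if l = i \<or> l = j then 1 else 0) = {i, j}"
  "supp (\<lambda>_. 0) = {}"
  by (auto simp: supp_def)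

lemma signed_identities_config:
  "(\<exists>x\<in>signed_identities n. config r x = (V, A)) \<longleftrightarrow> (\<exists>i\<in>{1..n}. V = {i} \<and> A = {1..r})"
proof -
  have "signed_identities n = (\<lambda>i. (\<lambda>l. if l = i then 1 else 0, id)) ` {1..n}"
    by (auto simp: signed_identities_def)
  then show ?thesis by (auto simp: supp_signs simp del: ex_simps)
qed

lemma transpose_young_iff:
  assumes "r \<le> n" "i \<in> {1..n}" "j \<in> {1..n}"
  shows "transpose i j \<in> young_perms n r \<longleftrightarrow> (i \<in> {1..r} \<longleftrightarrow> j \<in> {1..r})"
proof -
  have perm: "transpose i j permutes {1..n}" using assms by (intro permutes_swap_id)
  have "transpose i j \<in> young_perms n r \<longleftrightarrow> (\<lambda>_. 0, transpose i j) \<in> young n r"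
    by (simp add: young_def)
  also have "\<dots> \<longleftrightarrow> transpose i j ` {1..r} = {1..r}"
    using young_iff[OF assms(1)] perm by (simp add: supp_signs)
  also have "\<dots> \<longleftrightarrow> (i \<in> {1..r} \<longleftrightarrow> j \<in> {1..r})"
  proof
    assume eq: "transpose i j ` {1..r} = {1..r}"
    have "transpose i j i \<in> transpose i j ` {1..r} \<longleftrightarrow> i \<in> {1..r}"
      by (rule inj_image_mem_iff) simp
    then show "i \<in> {1..r} \<longleftrightarrow> j \<in> {1..r}" unfolding eq by simp
  qed (rule transpose_image_same)
  finally show ?thesis .
qed

lemma T2_config:
  assumes "r \<le> n"
  shows "(\<exists>x\<in>T2 n r. config r x = (V, A)) \<longleftrightarrow>
    (\<exists>i\<in>{1..n}. \<exists>j\<in>{1..n}. i \<noteq> j \<and> (i \<in> {1..r} \<longleftrightarrow> j \<in> {1..r}) \<and> V = {i, j} \<and> A = {1..r})"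
    (is "?L \<longleftrightarrow> ?R")
proof
  assume ?L
  then obtain v i j where x: "(v, transpose i j) \<in> signed_young n r - young n r"
    "config r (v, transpose i j) = (V, A)" "i \<in> {1..n}" "j \<in> {1..n}" "i \<noteq> j"
    "v = (\<lambda>_. 0) \<or> v = (\<lambda>l. if l = i \<or> l = j then 1 else 0)"
    by (auto simp: T2_def even_transpositions_def)
  have same: "i \<in> {1..r} \<longleftrightarrow> j \<in> {1..r}"
    using x(1) transpose_young_iff[OF assms x(3,4)] by (simp add: signed_young_def)
  have "v \<noteq> (\<lambda>_. 0)" using x(1) by (auto simp: signed_young_def young_def)
  then have "v = (\<lambda>l. if l = i \<or> l = j then 1 else 0)" using x(6) by blast
  then have "V = {i, j}" "A = {1..r}"
    using x(2) supp_signs(2)[of i j] transpose_image_same[OF same]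
    by (simp_all only: config.simps prod.inject)
  then show ?R using x(3-5) same by blast
next
  assume ?R
  then obtain i j where ij: "i \<in> {1..n}" "j \<in> {1..n}" "i \<noteq> j" "i \<in> {1..r} \<longleftrightarrow> j \<in> {1..r}"
    "V = {i, j}" "A = {1..r}" by blast
  let ?v = "\<lambda>l. if l = i \<or> l = j then 1 else (0 :: bit)"
  have "(?v, transpose i j) \<in> even_transpositions n"
    using ij by (auto simp: even_transpositions_def)
  moreover have "(?v, transpose i j) \<in> signed_young n r"
    using transpose_young_iff[OF assms ij(1,2)] ij
    by (simp only: signed_young_def mem_Times_iff fst_conv snd_conv bit_vectors_iff_supp supp_signs) simp
  moreover have "(?v, transpose i j) \<notin> young n r"
    using young_iff[OF assms] by (simp add: supp_signs)
  moreover have "config r (?v, transpose i j) = (V, A)"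
    using ij transpose_image_same[OF ij(4)] by (simp add: supp_signs)
  ultimately show ?L unfolding T2_def by blast
qed

lemma T3_config:
  assumes "r \<le> n"
  shows "(\<exists>x\<in>T3 n r. config r x = (V, A)) \<longleftrightarrow>
    (\<exists>i\<in>{1..n}. \<exists>j\<in>{1..n}. \<not> (i \<in> {1..r} \<longleftrightarrow> j \<in> {1..r}) \<and> (V = {} \<or> V = {i, j})
      \<and> A = transpose i j ` {1..r})"
    (is "?L \<longleftrightarrow> ?R")
proof
  assume ?L
  then obtain v i j where x: "(v, transpose i j) \<notin> signed_young n r"
    "config r (v, transpose i j) = (V, A)" "i \<in> {1..n}" "j \<in> {1..n}" "i \<noteq> j"
    "v = (\<lambda>_. 0) \<or> v = (\<lambda>l. if l = i \<or> l = j then 1 else 0)"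
    by (auto simp: T3_def even_transpositions_def)
  have VA: "V = supp v" "A = transpose i j ` {1..r}" using x(2) by (simp_all only: config.simps prod.inject)
  have V: "V = {} \<or> V = {i, j}" using x(6) supp_signs(2,3) unfolding VA(1) by metis
  then have "v \<in> bit_vectors n" using x(3,4) unfolding bit_vectors_iff_supp VA(1)
    by (elim disjE) (simp_all only: empty_subsetI insert_subset simp_thms)
  then have "\<not> (i \<in> {1..r} \<longleftrightarrow> j \<in> {1..r})"
    using x(1) transpose_young_iff[OF assms x(3,4)] by (simp add: signed_young_def)
  then show ?R using x(3,4) V VA(2) by blast
next
  assume ?R
  then obtain i j where ij: "i \<in> {1..n}" "j \<in> {1..n}" "\<not> (i \<in> {1..r} \<longleftrightarrow> j \<in> {1..r})"
    "V = {} \<or> V = {i, j}" "A = transpose i j ` {1..r}" by blast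
  define v :: "nat \<Rightarrow> bit" where
    "v = (if V = {} then (\<lambda>_. 0) else (\<lambda>l. if l = i \<or> l = j then 1 else 0))"
  have "supp v = V" using ij(4) unfolding v_def by (cases "V = {}") (simp_all only: supp_signs simp_thms if_True if_False)
  then have "config r (v, transpose i j) = (V, A)" using ij(5) by simp
  moreover have "(v, transpose i j) \<in> even_transpositions n"
    using ij(1-3) by (auto simp: even_transpositions_def v_def)
  moreover have "(v, transpose i j) \<notin> signed_young n r"
    using transpose_young_iff[OF assms ij(1,2)] ij(3) by (simp add: signed_young_def)
  ultimately show ?L unfolding T3_def by blast
qed

lemma transpose_image_eq_iff:
  assumes "a \<in> B" "b \<notin> B"
  shows "transpose a b ` B = transpose i j ` B \<longleftrightarrow> (i, j) = (a, b) \<or> (i, j) = (b, a)"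
proof
  assume eq: "transpose a b ` B = transpose i j ` B"
  have ab: "transpose a b ` B = insert b (B - {a})" using assms by (rule transpose_image_swap)
  have neq: "a \<noteq> b" using assms by auto
  consider "i \<in> B \<longleftrightarrow> j \<in> B" | "i \<in> B" "j \<notin> B" | "j \<in> B" "i \<notin> B" by blast
  then show "(i, j) = (a, b) \<or> (i, j) = (b, a)"
  proof cases
    case 1
    then show ?thesis using eq ab assms transpose_image_same[OF 1] by auto
  next
    case 2
    then have "insert b (B - {a}) = insert j (B - {i})" using eq ab transpose_image_swap(1) by metis
    then have "b \<in> insert j (B - {i})" "a \<notin> insert j (B - {i})" using neq by auto
    then show ?thesis using assms by auto
  next
    case 3
    then have "insert b (B - {a}) = insert i (B - {j})" using eq ab transpose_image_swap(2) by metis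
    then have "b \<in> insert i (B - {j})" "a \<notin> insert i (B - {j})" using neq by auto
    then show ?thesis using assms by auto
  qed
qed (auto simp: transpose_commute)

text \<open>
  The number of triples, made of two indices and a coin, whose move leads from the base configuration \<open>({}, {1..r})\<close> to \<open>y\<close>.
\<close>
definition move_count :: "nat \<Rightarrow> nat \<Rightarrow> nat set \<times> nat set \<Rightarrow> real" where
  "move_count n r y = (\<Sum>i\<in>{1..n}. \<Sum>j\<in>{1..n}.
     of_bool (y = ({}, transpose i j ` {1..r})) + of_bool (y = ({i, j}, transpose i j ` {1..r})))"

text \<open>
  The coefficients of \<open>Q\<close> are these counts: pairs on one side of \<open>{1..r}\<close> without a flip give the subgroup,
  a diagonal pair with a flip gives a signed identity (one triple), and an unordered pair \<open>{i, j}\<close> gives an element of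
  \<open>T2\<close> or \<open>T3\<close> (two triples, one for each order).
\<close>
lemma Q_eq_move_count:
  assumes rn: "r \<le> n" and n: "0 < n" and g: "g \<in> carrier (hyperoct n)"
  shows "Q n r g = move_count n r (config r g) / (2 * real n ^ 2 * (fact r * fact (n - r)))"
proof -
  obtain V A where VA: "config r g = (V, A)" by force
  let ?N = "{1..n}" and ?B = "{1..r}"
  define M1 where "M1 = {(i, j) \<in> ?N \<times> ?N. V = {} \<and> A = transpose i j ` ?B}"
  define M2 where "M2 = {(i, j) \<in> ?N \<times> ?N. V = {i, j} \<and> A = transpose i j ` ?B}"
  have count: "(\<Sum>i\<in>?N. \<Sum>j\<in>?N. of_bool (P i j)) = real (card {(i, j) \<in> ?N \<times> ?N. P i j})" for P
  proof -
    have "(\<Sum>i\<in>?N. \<Sum>j\<in>?N. of_bool (P i j)) = (\<Sum>x\<in>?N \<times> ?N. of_bool (P (fst x) (snd x)) :: real)"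
      by (simp only: sum.cartesian_product split_def)
    also have "\<dots> = real (card (?N \<times> ?N \<inter> {x. P (fst x) (snd x)}))"
      by (rule sum_of_bool_eq) auto
    also have "?N \<times> ?N \<inter> {x. P (fst x) (snd x)} = {(i, j) \<in> ?N \<times> ?N. P i j}" by auto
    finally show ?thesis .
  qed
  have mc: "move_count n r (config r g) = real (card M1) + real (card M2)"
    unfolding move_count_def sum.distrib count M1_def M2_def VA by simp
  have young: "g \<in> young n r \<longleftrightarrow> V = {} \<and> A = ?B"
    using young_iff_config[OF rn g] VA by simp
  have carr: "signed_identities n \<subseteq> carrier (hyperoct n)" "T2 n r \<subseteq> carrier (hyperoct n)"
    "T3 n r \<subseteq> carrier (hyperoct n)"
    unfolding signed_identities_def T2_def T3_def even_transpositions_def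
    by (auto simp: hyperoct_carrier_iff supp_signs permutes_id intro!: permutes_swap_id)
  note U = mem_set_mult_young_iff[OF rn carr(1) g, unfolded VA signed_identities_config]
  note T2 = mem_set_mult_young_iff[OF rn carr(2) g, unfolded VA T2_config[OF rn]]
  note T3 = mem_set_mult_young_iff[OF rn carr(3) g, unfolded VA T3_config[OF rn]]
  let ?U = "g \<in> signed_identities n <#>\<^bsub>hyperoct n\<^esub> young n r"
  let ?T2 = "g \<in> T2 n r <#>\<^bsub>hyperoct n\<^esub> young n r"
  let ?T3 = "g \<in> T3 n r <#>\<^bsub>hyperoct n\<^esub> young n r"
  have nn: "real n ^ 2 \<noteq> 0" using n by simp
  have "Q n r g * (2 * real n ^ 2 * (fact r * fact (n - r))) = real (card M1) + real (card M2)"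
  proof (cases "g \<in> young n r")
    case True
    then have V: "V = {}" "A = ?B" using young by auto
    have fix_iff: "?B = transpose i j ` ?B \<longleftrightarrow> (i \<in> ?B \<longleftrightarrow> j \<in> ?B)" for i j
    proof
      assume eq: "?B = transpose i j ` ?B"
      have "transpose i j i \<in> transpose i j ` ?B \<longleftrightarrow> i \<in> ?B" by (rule inj_image_mem_iff) simp
      then show "i \<in> ?B \<longleftrightarrow> j \<in> ?B" unfolding eq[symmetric] by simp
    qed (rule transpose_image_same[symmetric])
    have "M1 = ?B \<times> ?B \<union> (?N - ?B) \<times> (?N - ?B)"
      unfolding M1_def V fix_iff using rn by auto
    moreover have "M2 = {}" by (auto simp: M2_def V)
    moreover have "card (?B \<times> ?B \<union> (?N - ?B) \<times> (?N - ?B)) = r * r + (n - r) * (n - r)"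
      using rn by (subst card_Un_disjoint) (auto simp: card_cartesian_product card_Diff_subset)
    ultimately have "real (card M1) + real (card M2) = real r * real r + real (n - r) * real (n - r)"
      by (simp only: of_nat_add of_nat_mult card.empty of_nat_0 add_0_right)
    also have "\<dots> = real n ^ 2 - 2 * real r * (real n - real r)"
      unfolding of_nat_diff[OF rn] by (simp add: power2_eq_square algebra_simps)
    finally have "real (card M1) + real (card M2) = real n ^ 2 - 2 * real r * (real n - real r)" .
    then show ?thesis using True nn by (simp add: Q_def)
  next
    case notK: False
    show ?thesis
    proof (cases ?U)
      case True
      then obtain a where a: "a \<in> ?N" "V = {a}" "A = ?B" using U by blast
      have "M1 = {}" "M2 = {(a, a)}" using a by (auto simp: M1_def M2_def)
      then show ?thesis using notK True nn by (simp add: Q_def)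
    next
      case notU: False
      show ?thesis
      proof (cases ?T2)
        case True
        then obtain a b where ab: "a \<in> ?N" "b \<in> ?N" "a \<noteq> b" "a \<in> ?B \<longleftrightarrow> b \<in> ?B"
          "V = {a, b}" "A = ?B" using T2 by blast
        have "?B = transpose a b ` ?B" "?B = transpose b a ` ?B"
          using ab(4) by (intro transpose_image_same[symmetric]; simp)+
        then have "(i, j) \<in> M2 \<longleftrightarrow> (i, j) = (a, b) \<or> (i, j) = (b, a)" for i j
          unfolding M2_def mem_Collect_eq prod.case mem_Times_iff fst_conv snd_conv prod.inject ab(5,6)
            doubleton_eq_iff
          using ab(1,2) by blast
        then have "M2 = {(a, b), (b, a)}" by auto
        moreover have "M1 = {}" by (simp add: M1_def ab(5))
        ultimately show ?thesis using ab(3) notK notU True nn by (simp add: Q_def)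
      next
        case notT2: False
        show ?thesis
        proof (cases ?T3)
          case True
          then obtain i j where ij: "i \<in> ?N" "j \<in> ?N" "\<not> (i \<in> ?B \<longleftrightarrow> j \<in> ?B)"
            "V = {} \<or> V = {i, j}" "A = transpose i j ` ?B" using T3 by blast
          obtain a b where ab: "a \<in> ?N" "b \<in> ?N" "a \<in> ?B" "b \<notin> ?B"
            "V = {} \<or> V = {a, b}" "A = transpose a b ` ?B"
          proof (cases "i \<in> ?B")
            case True
            then show ?thesis using ij by (intro that[of i j]) blast+
          next
            case False
            have "V = {} \<or> V = {j, i}" "A = transpose j i ` ?B"
              using ij(4,5) by (simp_all only: transpose_commute insert_commute)
            then show ?thesis using ij False by (intro that[of j i]) blast+
          qed
          have neq: "a \<noteq> b" using ab(3,4) by blast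
          have "card M1 + card M2 = 2"
          proof (cases "V = {}")
            case True
            then have "(i, j) \<in> M1 \<longleftrightarrow> (i, j) = (a, b) \<or> (i, j) = (b, a)" for i j
              unfolding M1_def mem_Collect_eq prod.case mem_Times_iff fst_conv snd_conv ab(6)
                transpose_image_eq_iff[OF ab(3,4)]
              using ab(1,2) by blast
            then have "M1 = {(a, b), (b, a)}" by auto
            moreover have "M2 = {}" by (simp add: M2_def True)
            ultimately show ?thesis using neq by simp
          next
            case False
            then have "V = {a, b}" using ab(5) by blast
            then have "(i, j) \<in> M2 \<longleftrightarrow> (i, j) = (a, b) \<or> (i, j) = (b, a)" for i j
              unfolding M2_def mem_Collect_eq prod.case mem_Times_iff fst_conv snd_conv ab(6)
                transpose_image_eq_iff[OF ab(3,4)]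
              using ab(1,2) by blast
            then have "M2 = {(a, b), (b, a)}" by auto
            moreover have "M1 = {}" by (simp add: M1_def False)
            ultimately show ?thesis using neq by simp
          qed
          then have "real (card M1) + real (card M2) = 2" by linarith
          then show ?thesis using notK notU notT2 True nn by (simp add: Q_def)
        next
          case notT3: False
          have "(i, j) \<notin> M1 \<and> (i, j) \<notin> M2" for i j
          proof (cases "i \<in> ?B \<longleftrightarrow> j \<in> ?B")
            case True
            then have "transpose i j ` ?B = ?B" by (rule transpose_image_same)
            moreover have False if "V = {i, j}" "A = ?B" "i \<in> ?N" "j \<in> ?N"
            proof (cases "i = j")
              case True
              with that have "V = {i}" by simp
              then show False using notU[unfolded U] that(2,3) by blast
            next
              case False
              then show False using notT2[unfolded T2] that True by blast
            qed
            ultimately show ?thesis using notK[unfolded young]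
              unfolding M1_def M2_def mem_Collect_eq prod.case mem_Times_iff fst_conv snd_conv by blast
          next
            case False
            then show ?thesis using notT3[unfolded T3]
              unfolding M1_def M2_def mem_Collect_eq prod.case mem_Times_iff fst_conv snd_conv by blast
          qed
          then have "M1 = {}" "M2 = {}" by auto
          then show ?thesis using notK notU notT2 notT3 by (simp add: Q_def)
        qed
      qed
    qed
  qed
  then show ?thesis unfolding mc using nn by (simp add: eq_divide_eq)
qed

lemma sym_diff_eq_iff: "sym_diff X Y = Z \<longleftrightarrow> X = sym_diff Y Z"
  by (simp only: set_eq_iff) blast

text \<open>
  Conjugation by the permutation of \<open>h\<close> renames the indices, so the moves from \<open>config r h\<close> look like those from the base
  configuration.
\<close>
lemma move_count_quotient:
  assumes h: "h \<in> carrier (hyperoct n)" and g: "g \<in> carrier (hyperoct n)" "config r g = (W, A)"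
  shows "move_count n r (config r (inv\<^bsub>hyperoct n\<^esub> h \<otimes>\<^bsub>hyperoct n\<^esub> g))
    = (\<Sum>i\<in>{1..n}. \<Sum>j\<in>{1..n}. of_bool (config r h = (W, transpose i j ` A))
        + of_bool (config r h = (sym_diff W {i, j}, transpose i j ` A)))"
proof -
  let ?N = "{1..n}" and ?B = "{1..r}"
  obtain v p where hp: "h = (v, p)" by force
  obtain w q where gq: "g = (w, q)" by force
  have p: "p permutes ?N" using h by (simp add: hp hyperoct_carrier_iff)
  have bij: "bij p" "inj p" using permutes_bij[OF p] permutes_inj[OF p] .
  let ?p' = "inv_into UNIV p"
  have pp': "p ` ?p' ` X = X" "?p' ` p ` X = X" for X
    using permutes_inv_o[OF p] by (simp_all only: image_comp image_id id_apply)
  have eq_iff: "?p' ` X = Y \<longleftrightarrow> X = p ` Y" for X Y using pp' by metis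
  define D where "D = sym_diff (supp v) W"
  have W: "W = supp w" and A: "A = q ` ?B" using g(2) by (auto simp: gq)
  have "inv\<^bsub>hyperoct n\<^esub> h \<otimes>\<^bsub>hyperoct n\<^esub> g = (\<lambda>i. v (p i) + w (p i), ?p' \<circ> q)"
    unfolding hp gq hyperoct_inv[OF h[unfolded hp]] hyperoct_mult inv_inv_eq[OF bij(1)] ..
  moreover have "supp (\<lambda>i. v (p i) + w (p i)) = ?p' ` D"
  proof -
    have "supp (\<lambda>i. v (p i) + w (p i)) = sym_diff (supp (\<lambda>i. v (p i))) (supp (\<lambda>i. w (p i)))"
      by (rule supp_add)
    also have "\<dots> = p -` D" by (auto simp: supp_def D_def W)
    also have "\<dots> = ?p' ` D" by (rule bij_vimage_eq_inv_image[OF bij(1)])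
    finally show ?thesis .
  qed
  ultimately have conf: "config r (inv\<^bsub>hyperoct n\<^esub> h \<otimes>\<^bsub>hyperoct n\<^esub> g) = (?p' ` D, ?p' ` A)"
    unfolding A by (simp add: image_comp)
  let ?F = "\<lambda>i j. of_bool (config r h = (W, transpose i j ` A))
        + (of_bool (config r h = (sym_diff W {i, j}, transpose i j ` A)) :: real)"
  have involution: "transpose a b ` transpose a b ` X = X" for a b :: nat and X
    by (simp add: image_comp)
  have summand: "of_bool ((?p' ` D, ?p' ` A) = ({}, transpose i j ` ?B))
      + of_bool ((?p' ` D, ?p' ` A) = ({i, j}, transpose i j ` ?B)) = ?F (p i) (p j)" for i j
  proof -
    have "?p' ` A = transpose i j ` ?B \<longleftrightarrow> A = transpose (p i) (p j) ` p ` ?B"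
      unfolding eq_iff transpose_image_conj[OF bij(2)] ..
    also have "\<dots> \<longleftrightarrow> p ` ?B = transpose (p i) (p j) ` A"
      using involution by metis
    finally have 1: "?p' ` A = transpose i j ` ?B \<longleftrightarrow> p ` ?B = transpose (p i) (p j) ` A" .
    have 2: "?p' ` D = {} \<longleftrightarrow> supp v = W" by (auto simp: D_def)
    have "?p' ` D = {i, j} \<longleftrightarrow> D = {p i, p j}" unfolding eq_iff by simp
    also have "\<dots> \<longleftrightarrow> supp v = sym_diff W {p i, p j}"
      unfolding D_def by (rule sym_diff_eq_iff)
    finally have 3: "?p' ` D = {i, j} \<longleftrightarrow> supp v = sym_diff W {p i, p j}" .
    show ?thesis unfolding hp config.simps prod.inject 1 2 3 ..
  qed
  have reindex: "(\<Sum>i\<in>?N. f (p i)) = (\<Sum>i\<in>?N. f i)" for f :: "nat \<Rightarrow> real"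
    using sum.reindex_bij_betw[OF permutes_imp_bij[OF p]] by blast
  have "move_count n r (config r (inv\<^bsub>hyperoct n\<^esub> h \<otimes>\<^bsub>hyperoct n\<^esub> g)) = (\<Sum>i\<in>?N. \<Sum>j\<in>?N. ?F (p i) (p j))"
    unfolding move_count_def conf summand ..
  also have "\<dots> = (\<Sum>i\<in>?N. \<Sum>j\<in>?N. ?F i j)"
    unfolding reindex[of "\<lambda>j. ?F (p _) j"] reindex[of "\<lambda>i. \<Sum>j\<in>?N. ?F i j"] ..
  finally show ?thesis .
qed

text \<open>
  The step probability depends on the cosets of its two arguments only, so the sum over the group collapses to a sum over
  configurations; the size of a fibre cancels the factorials in \<open>Q\<close>.
\<close>
lemma induced_convolution_power_eq_walk:
  assumes rn: "r \<le> n" and n: "0 < n" and y: "(W, A) \<in> configs n r"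
  shows "induced (convolution_power (hyperoct n) (Q n r) k) (fibre n r (W, A)) = walk {1..n} {1..r} k W A"
  using y
proof (induction k arbitrary: W A)
  case 0
  let ?one = "(\<lambda>_. 0, id) :: signed_perm"
  have "induced (convolution_power (hyperoct n) (Q n r) 0) (fibre n r (W, A))
    = (\<Sum>g\<in>fibre n r (W, A). if g = ?one then 1 else 0)"
    by (simp add: induced_def hyperoct_def)
  also have "\<dots> = of_bool (?one \<in> fibre n r (W, A))"
    by (subst sum.delta) (simp_all add: fibre_def finite_hyperoct)
  also have "?one \<in> fibre n r (W, A) \<longleftrightarrow> W = {} \<and> A = {1..r}"
    by (auto simp: fibre_def hyperoct_carrier_iff supp_signs permutes_id)
  finally show ?case by simp
next
  case (Suc k)
  let ?G = "hyperoct n" and ?N = "{1..n}"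
  let ?p = "convolution_power ?G (Q n r) k"
  let ?f = "fact r * fact (n - r) :: real"
  let ?F = "\<lambda>h i j. of_bool (config r h = (W, transpose i j ` A))
        + (of_bool (config r h = (sym_diff W {i, j}, transpose i j ` A)) :: real)"
  interpret group ?G by (rule hyperoct_group)
  have at: "(\<Sum>h\<in>carrier ?G. ?p h * of_bool (config r h = z)) = walk ?N {1..r} k (fst z) (snd z)"
    if "z \<in> configs n r" for z
  proof -
    have "(\<Sum>h\<in>carrier ?G. ?p h * of_bool (config r h = z)) = (\<Sum>h\<in>fibre n r z. ?p h)"
      by (rule sum.mono_neutral_cong_right) (auto simp: fibre_def finite_hyperoct)
    then show ?thesis using Suc.IH[of "fst z" "snd z"] that by (simp add: induced_def)
  qed
  have closed: "(W, transpose i j ` A) \<in> configs n r" "(sym_diff W {i, j}, transpose i j ` A) \<in> configs n r"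
    if "i \<in> ?N" "j \<in> ?N" for i j
    using Suc.prems that permutes_image_subsets_of_card[OF permutes_swap_id[OF that]]
    by (auto simp: configs_def)
  have step: "convolution_power ?G (Q n r) (Suc k) g = walk ?N {1..r} (Suc k) W A / ?f"
    if g: "g \<in> fibre n r (W, A)" for g
  proof -
    have gG: "g \<in> carrier ?G" "config r g = (W, A)" using g by (auto simp: fibre_def)
    have "convolution_power ?G (Q n r) (Suc k) g = (\<Sum>h\<in>carrier ?G. ?p h * Q n r (inv\<^bsub>?G\<^esub> h \<otimes>\<^bsub>?G\<^esub> g))"
      by (rule convolution_power_Suc_right[OF hyperoct_group finite_hyperoct gG(1)])
    also have "\<dots> = (\<Sum>h\<in>carrier ?G. ?p h * ((\<Sum>i\<in>?N. \<Sum>j\<in>?N. ?F h i j) / (2 * real n ^ 2 * ?f)))"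
    proof (rule sum.cong[OF refl])
      fix h assume h: "h \<in> carrier ?G"
      have "inv\<^bsub>?G\<^esub> h \<otimes>\<^bsub>?G\<^esub> g \<in> carrier ?G" using h gG by simp
      then show "?p h * Q n r (inv\<^bsub>?G\<^esub> h \<otimes>\<^bsub>?G\<^esub> g) = ?p h * ((\<Sum>i\<in>?N. \<Sum>j\<in>?N. ?F h i j) / (2 * real n ^ 2 * ?f))"
        by (simp only: Q_eq_move_count[OF rn n] move_count_quotient[OF h gG])
    qed
    also have "\<dots> = (\<Sum>h\<in>carrier ?G. \<Sum>i\<in>?N. \<Sum>j\<in>?N. ?p h * ?F h i j) / (2 * real n ^ 2 * ?f)"
      by (simp only: sum_distrib_left sum_divide_distrib times_divide_eq_right)
    also have "(\<Sum>h\<in>carrier ?G. \<Sum>i\<in>?N. \<Sum>j\<in>?N. ?p h * ?F h i j)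
      = (\<Sum>i\<in>?N. \<Sum>j\<in>?N. \<Sum>h\<in>carrier ?G. ?p h * ?F h i j)"
      by (subst sum.swap, rule sum.cong[OF refl], rule sum.swap)
    also have "\<dots> = (\<Sum>i\<in>?N. \<Sum>j\<in>?N. walk ?N {1..r} k W (transpose i j ` A)
        + walk ?N {1..r} k (sym_diff W {i, j}) (transpose i j ` A))"
    proof (rule sum.cong[OF refl], rule sum.cong[OF refl])
      fix i j assume ij: "i \<in> ?N" "j \<in> ?N"
      show "(\<Sum>h\<in>carrier ?G. ?p h * ?F h i j) = walk ?N {1..r} k W (transpose i j ` A)
        + walk ?N {1..r} k (sym_diff W {i, j}) (transpose i j ` A)"
        unfolding distrib_left sum.distrib at[OF closed(1)[OF ij]] at[OF closed(2)[OF ij]] by simp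
    qed
    also have "\<dots> / (2 * real n ^ 2 * ?f) = walk ?N {1..r} (Suc k) W A / ?f"
      by simp
    finally show ?thesis .
  qed
  have "induced (convolution_power ?G (Q n r) (Suc k)) (fibre n r (W, A))
    = (\<Sum>g\<in>fibre n r (W, A). walk ?N {1..r} (Suc k) W A / ?f)"
    unfolding induced_def by (rule sum.cong[OF refl]) (rule step)
  also have "\<dots> = real (card (fibre n r (W, A))) * (walk ?N {1..r} (Suc k) W A / ?f)"
    by (rule sum_constant)
  also have "\<dots> = walk ?N {1..r} (Suc k) W A"
    unfolding card_fibre[OF rn Suc.prems] by (simp del: walk.simps)
  finally show ?case .
qed

section \<open>The distance bounds\<close>

lemma tv_dist_le_l2_dist: "tv_dist X \<mu> \<nu> \<le> 1 / 2 * sqrt (real (card X)) * l2_dist X \<mu> \<nu>"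
proof -
  have "(\<Sum>x\<in>X. \<bar>\<mu> x - \<nu> x\<bar>) ^ 2 \<le> (\<Sum>x\<in>X. \<bar>\<mu> x - \<nu> x\<bar> ^ 2) * real (card X)"
    by (rule sum_squared_le_sum_of_squares)
  then have "(\<Sum>x\<in>X. \<bar>\<mu> x - \<nu> x\<bar>) \<le> sqrt ((\<Sum>x\<in>X. \<bar>\<mu> x - \<nu> x\<bar> ^ 2) * real (card X))"
    by (rule real_le_rsqrt)
  then show ?thesis by (simp add: tv_dist_def l2_dist_def real_sqrt_mult mult.commute)
qed

lemma scaled_l2_dist_bound:
  fixes n r k :: nat and c :: real
  assumes r: "1 \<le> r" "2 * r \<le> n" and c: "0 < c" and k: "real k = 1 / 2 * real n * (ln (real n) + c)"
  defines "X \<equiv> cosets n r" and "P \<equiv> induced (convolution_power (hyperoct n) (Q n r) k)"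
  shows "2 ^ n * real (n choose r) * l2_dist X P (uniform_mass X) ^ 2
    \<le> 8 * exp (- c) * (2 * exp 1 * exp (4 * exp 1))"
proof -
  let ?N = "{1..n}"
  let ?M = "2 ^ n * real (n choose r)"
  have rn: "r \<le> n" "0 < n" "2 \<le> n" using r by auto
  have bij: "bij_betw (fibre n r) (configs n r) X" unfolding X_def by (rule bij_betw_fibre[OF rn(1)])
  have "card X = 2 ^ n * (n choose r)" using bij_betw_same_card[OF bij] by (simp only: card_configs)
  then have cX: "real (card X) = ?M" by simp
  have B: "{1..r} \<in> subsets_of_card ?N r" using rn by auto
  have "l2_dist X P (uniform_mass X) ^ 2 = (\<Sum>C\<in>X. (P C - uniform_mass X C) ^ 2)"
    by (simp add: l2_dist_def sum_nonneg)
  also have "\<dots> = (\<Sum>y\<in>configs n r. (P (fibre n r y) - uniform_mass X (fibre n r y)) ^ 2)"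
    by (rule sum.reindex_bij_betw[OF bij, symmetric])
  also have "\<dots> = (\<Sum>(W, A)\<in>configs n r. (walk ?N {1..r} k W A - 1 / ?M) ^ 2)"
  proof (rule sum.cong[OF refl])
    fix y assume y: "y \<in> configs n r"
    have "fibre n r y \<in> X" using y bij by (auto simp: bij_betw_def)
    then have "uniform_mass X (fibre n r y) = 1 / ?M" by (simp add: uniform_mass_def cX)
    then show "(P (fibre n r y) - uniform_mass X (fibre n r y)) ^ 2
      = (case y of (W, A) \<Rightarrow> (walk ?N {1..r} k W A - 1 / ?M) ^ 2)"
      using induced_convolution_power_eq_walk[OF rn(1,2), of "fst y" "snd y" k] y
      by (simp add: P_def split_def)
  qed
  also have "\<dots> = (\<Sum>W\<in>Pow ?N. \<Sum>A\<in>subsets_of_card ?N r. (walk ?N {1..r} k W A - 1 / ?M) ^ 2)"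
    unfolding configs_def by (simp add: sum.cartesian_product)
  also have "\<dots> = (\<Sum>A\<in>subsets_of_card ?N r. \<Sum>W\<in>Pow ?N. (walk ?N {1..r} k W A - 1 / ?M) ^ 2)"
    by (rule sum.swap)
  finally have "?M * l2_dist X P (uniform_mass X) ^ 2
     = ?M * (\<Sum>A\<in>subsets_of_card ?N r. \<Sum>W\<in>Pow ?N. (walk ?N {1..r} k W A - 1 / ?M) ^ 2)"
    by simp
  also have "\<dots> = (\<Sum>S\<in>Pow ?N. \<Sum>A\<in>subsets_of_card ?N r. (sector S (?N - S) ^^ (2 * k)) (point A) A)
      / (real n ^ 2) ^ (2 * k) - 1"
    using walk_l2_eq_trace[of ?N "{1..r}" r k] B rn by simp
  also have "\<dots> \<le> 8 * exp (- c) * (2 * exp 1 * exp (4 * exp 1))"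
    using total_trace_bound[of ?N c "2 * k" r] rn r c k by simp
  finally show ?thesis .
qed

theorem theorem3p4p3:
  shows "\<exists>b::real. b > 0 \<and>
    (\<forall>(n::nat) (r::nat) (c::real) (k::nat).
       1 \<le> r \<longrightarrow> real r \<le> real n / 2 \<longrightarrow> c > 0 \<longrightarrow>
       real k = 1 / 2 * real n * (ln (real n) + c) \<longrightarrow>
       (let X = cosets n r;
            P = induced (convolution_power (hyperoct n) (Q n r) k);
            U = uniform_mass X
        in tv_dist X P U \<le> 1 / 2 * sqrt (2 ^ n * real (n choose r)) * l2_dist X P U \<and>
           1 / 2 * sqrt (2 ^ n * real (n choose r)) * l2_dist X P U \<le> b * exp (- c / 2)))"
proof -
  define D :: real where "D = 16 * exp 1 * exp (4 * exp 1)"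
  have D: "0 < D" by (simp add: D_def)
  show ?thesis
  proof (intro exI[of _ "sqrt D / 2"] conjI allI impI)
    fix n r k :: nat and c :: real
    assume r: "1 \<le> r" "real r \<le> real n / 2" and c: "0 < c"
      and k: "real k = 1 / 2 * real n * (ln (real n) + c)"
    have rn: "2 * r \<le> n" using r(2) by linarith
    let ?X = "cosets n r" and ?M = "2 ^ n * real (n choose r)"
    let ?P = "induced (convolution_power (hyperoct n) (Q n r) k)"
    let ?l = "l2_dist ?X ?P (uniform_mass ?X)"
    have "card ?X = 2 ^ n * (n choose r)"
      using bij_betw_same_card[OF bij_betw_fibre] rn card_configs by (metis add_leD1 mult_2)
    then have tv: "tv_dist ?X ?P (uniform_mass ?X) \<le> 1 / 2 * sqrt ?M * ?l"
      using tv_dist_le_l2_dist[of ?X ?P "uniform_mass ?X"] by simp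
    have "(sqrt ?M * ?l) ^ 2 \<le> (sqrt D * exp (- c / 2)) ^ 2"
    proof -
      have "(sqrt ?M * ?l) ^ 2 = ?M * ?l ^ 2" by (simp add: power_mult_distrib)
      also have "\<dots> \<le> 8 * exp (- c) * (2 * exp 1 * exp (4 * exp 1))"
        by (rule scaled_l2_dist_bound[OF r(1) rn c k])
      also have "\<dots> = D * exp (- c)" by (simp add: D_def)
      also have "\<dots> = (sqrt D * exp (- c / 2)) ^ 2"
        using D by (simp add: power_mult_distrib exp_double[symmetric])
      finally show ?thesis .
    qed
    then have "sqrt ?M * ?l \<le> sqrt D * exp (- c / 2)"
      by (rule power2_le_imp_le) (use D in auto)
    then show "let X = cosets n r; P = induced (convolution_power (hyperoct n) (Q n r) k); U = uniform_mass X
        in tv_dist X P U \<le> 1 / 2 * sqrt (2 ^ n * real (n choose r)) * l2_dist X P U \<and>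
           1 / 2 * sqrt (2 ^ n * real (n choose r)) * l2_dist X P U \<le> sqrt D / 2 * exp (- c / 2)"
      using tv unfolding Let_def by simp
  qed (use D in simp)
qed

end
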